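(* Let $n$ and $k$ be positive integers with $k \ge 2$. For every integer $m \ge n+k+2$ and every graph $G$ with $\chi_P(G)=k$ and $|V(G)|=n$: if there is a special enumeration of $V(G)$, then $\chi_P(R_m(G))=k$; otherwise, $\chi_P(R_m(G))=k+1$.
   Context: Graphs are finite and simple; $[m]=\{1,\dots,m\}$. For a set $X$ of vertices of $G$, $\chi(X)$ denotes the chromatic number of the subgraph of $G$ induced by $X$. A path-decomposition of a graph $G$ is a sequence $B_1,\dots,B_s$ of subsets of $V(G)$ (bags) such that $V(G)=\bigcup_t B_t$; for each $uv\in E(G)$ there is $t$ with $u,v\in B_t$; and for each $v\in V(G)$ the sets $B_t$ containing $v$ are consecutive in the sequence. The chromatic number of a path-decomposition is $\max_t \chi(B_t)$. The path-chromatic number $\chi_P(G)$ is the minimum chromatic number over all path-decompositions of $G$. The closed neighborhood $N[U]$ of a set $U$ of vertices is $U$ together with all vertices having a neighbor in $U$. For an enumeration $\sigma=v_1,\dots,v_n$ of $V(G)$ (each vertex listed exactly once), $P_\sigma^G$ is the sequence $X_1,\dots,X_n$ with $X_\ell=N[\{v_1,\dots,v_\ell\}]\setminus\{v_1,\dots,v_{\ell-1}\}$; it is a path-decomposition of $G$, and $\chi(P_\sigma^G)=\max_\ell\chi(X_\ell)$ is its chromatic number. The enumeration $\sigma$ is special if (i) $\chi(P_\sigma^G)=\chi_P(G)$ and (ii) for every $1\le i\le n$ with $\chi(X_i)=\chi_P(G)$, the vertex $v_i$ has no neighbor in $\{v_1,\dots,v_{i-1}\}$. For a graph $G$ and a positive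 integer $m$, $R_m(G)$ is the graph with vertex set $\{(i,v): i\in[m],\ v\in V(G)\cup\{v_0\}\}$, where $v_0\notin V(G)$ is a new element, in which two distinct vertices $(i,v)$ and $(i',v')$ are adjacent if and only if either $i=i'$ and exactly one of $v,v'$ equals $v_0$, or $i\ne i'$, $v,v'\in V(G)$ and $vv'\in E(G)$. *)

theory Defs
  imports "Graph_Theory.Graph_Theory"
begin

text \<open>
  A finite simple graph is a \<open>pair_graph\<close>: a finite, symmetric, loop-free digraph on
  \<^const>\<open>pverts\<close> whose arcs \<^const>\<open>parcs\<close> are ordered pairs, each edge
  \<open>uv\<close> being the two arcs \<open>(u, v)\<close> and \<open>(v, u)\<close>.
\<close>

definition proper_colouring :: "('a, 'b) pre_digraph \<Rightarrow> nat \<Rightarrow> ('a \<Rightarrow> nat) \<Rightarrow> bool" where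
  "proper_colouring G q c \<longleftrightarrow>
     (\<forall>v \<in> verts G. c v < q) \<and> (\<forall>u v. u \<rightarrow>\<^bsub>G\<^esub> v \<longrightarrow> c u \<noteq> c v)"

definition chromatic_number :: "('a, 'b) pre_digraph \<Rightarrow> nat" where
  "chromatic_number G = (LEAST q. \<exists>c. proper_colouring G q c)"

definition chi :: "'a pair_pre_digraph \<Rightarrow> 'a set \<Rightarrow> nat" where
  "chi G X = chromatic_number (with_proj G \<restriction> X)"

definition path_decomposition :: "'a pair_pre_digraph \<Rightarrow> 'a set list \<Rightarrow> bool" where
  "path_decomposition G B \<longleftrightarrow>
     B \<noteq> [] \<and>
     (\<forall>X \<in> set B. X \<subseteq> pverts G) \<and>
     pverts G = \<Union> (set B) \<and>
     (\<forall>(u, v) \<in> parcs G. \<exists>X \<in> set B. u \<in> X \<and> v \<in> X) \<and>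
     (\<forall>v \<in> pverts G. \<forall>r s t. r \<le> s \<and> s \<le> t \<and> t < length B \<and> v \<in> B ! r \<and> v \<in> B ! t
        \<longrightarrow> v \<in> B ! s)"

definition decomposition_chromatic_number :: "'a pair_pre_digraph \<Rightarrow> 'a set list \<Rightarrow> nat" where
  "decomposition_chromatic_number G B = Max (chi G ` set B)"

definition path_chromatic_number :: "'a pair_pre_digraph \<Rightarrow> nat" where
  "path_chromatic_number G =
     (LEAST q. \<exists>B. path_decomposition G B \<and> decomposition_chromatic_number G B = q)"

definition closed_nbhd :: "'a pair_pre_digraph \<Rightarrow> 'a set \<Rightarrow> 'a set" where
  "closed_nbhd G U = U \<union> {w \<in> pverts G. \<exists>u \<in> U. (w, u) \<in> parcs G}"

definition enumeration :: "'a pair_pre_digraph \<Rightarrow> 'a list \<Rightarrow> bool" where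
  "enumeration G \<sigma> \<longleftrightarrow> distinct \<sigma> \<and> set \<sigma> = pverts G"

text \<open>
  Lists are indexed from 0, so \<open>\<sigma> ! l\<close> is \<open>v\<close> with index \<open>l + 1\<close>, and entry \<open>l\<close> of
  \<open>P_enum G \<sigma>\<close> is the bag \<open>X\<close> with index \<open>l + 1\<close>.
\<close>

definition P_enum :: "'a pair_pre_digraph \<Rightarrow> 'a list \<Rightarrow> 'a set list" where
  "P_enum G \<sigma> =
     map (\<lambda>l. closed_nbhd G (set (take (Suc l) \<sigma>)) - set (take l \<sigma>)) [0..<length \<sigma>]"

definition special_enumeration :: "'a pair_pre_digraph \<Rightarrow> 'a list \<Rightarrow> bool" where
  "special_enumeration G \<sigma> \<longleftrightarrow>
     enumeration G \<sigma> \<and>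
     decomposition_chromatic_number G (P_enum G \<sigma>) = path_chromatic_number G \<and>
     (\<forall>i < length \<sigma>. chi G (P_enum G \<sigma> ! i) = path_chromatic_number G
        \<longrightarrow> (\<forall>u \<in> set (take i \<sigma>). (\<sigma> ! i, u) \<notin> parcs G))"

text \<open>The new vertex \<open>v\<^sub>0\<close> is \<^const>\<open>None\<close>; a vertex \<open>v\<close> of \<open>G\<close> becomes \<open>Some v\<close>.\<close>

definition R_graph :: "nat \<Rightarrow> 'a pair_pre_digraph \<Rightarrow> (nat \<times> 'a option) pair_pre_digraph" where
  "R_graph m G = \<lparr>
     pverts = {1..m} \<times> insert None (Some ` pverts G),
     parcs = {((i, x), (j, y)) | i x j y.
       (i, x) \<in> {1..m} \<times> insert None (Some ` pverts G) \<and>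
       (j, y) \<in> {1..m} \<times> insert None (Some ` pverts G) \<and>
       (i = j \<and> (x = None) \<noteq> (y = None) \<or>
        i \<noteq> j \<and> (\<exists>u v. x = Some u \<and> y = Some v \<and> (u, v) \<in> parcs G))} \<rparr>"

end

theory Submission
  imports Defs
begin

text \<open>
  Suppose \<open>R\<^sub>m(G)\<close> has a path-decomposition with \<open>k\<close>-colourable bags, so that every vertex becomes
  an interval of bag indices. If \<open>k + 1\<close> copies of \<open>v\<close> lie in one bag, two of them share a colour;
  giving \<open>v\<close> such a repeated colour is a proper \<open>k\<close>-colouring of the vertices with many copies in
  the bag. If moreover these vertices cannot be coloured with \<open>k - 1\<close> colours, then for each colour
  there is a vertex all of whose copies in the bag have that colour, and hence a layer whose centre
  is in the bag cannot be present completely.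

  Order the vertices of \<open>G\<close> by the first end of one of their copies. In bags where at most \<open>k\<close>
  centres have ended and at most \<open>k\<close> have not yet started, at least \<open>m - 2k\<close> centres are
  present. If \<open>v\<^sub>\<ell>\<close> has an earlier neighbour and \<open>\<chi>(X\<^sub>\<ell>) = k\<close>, each of these
  centres forces its own vertex among \<open>v\<^sub>1, \<dots>, v\<^sub>\<ell>\<close>, while \<open>|X\<^sub>\<ell>| \<ge> k\<close>; this
  contradicts \<open>m \<ge> n + k + 2\<close>. Near the two ends of the decomposition, a bag where a centre
  starts or ends contains a complete layer, so the vertices concerned are \<open>(k - 1)\<close>-colourable and
  can be enumerated with little care.

  Conversely, given a special enumeration, all centres are put in all bags. Where
  \<open>\<chi>(X\<^sub>\<ell>) = k\<close>, the copies of \<open>v\<^sub>\<ell>\<close> are passed one layer at a time: in the bag of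
  layer \<open>i\<close> the last colour goes to the whole of layer \<open>i\<close> and to all the other centres.
\<close>

section \<open>Colourability of vertex sets\<close>

text \<open>Stands in for \<open>chi\<close>: monotone in the set and in the number of colours, and
  free of \<open>LEAST\<close> and of induced subgraphs.\<close>

definition colourable :: "'a pair_pre_digraph \<Rightarrow> 'a set \<Rightarrow> nat \<Rightarrow> bool" where
  "colourable G X q \<longleftrightarrow>
     (\<exists>c. (\<forall>v \<in> X. c v < q) \<and> (\<forall>u \<in> X. \<forall>v \<in> X. (u, v) \<in> parcs G \<longrightarrow> c u \<noteq> c v))"

lemma colourableI:
  assumes "\<And>v. v \<in> X \<Longrightarrow> c v < q"
    and "\<And>u v. u \<in> X \<Longrightarrow> v \<in> X \<Longrightarrow> (u, v) \<in> parcs G \<Longrightarrow> c u \<noteq> c v"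
  shows "colourable G X q"
  using assms unfolding colourable_def by blast

lemma colourable_mono:
  assumes "colourable G Y q" and "X \<subseteq> Y" and "q \<le> q'"
  shows "colourable G X q'"
proof -
  obtain c where "\<forall>v \<in> Y. c v < q" "\<forall>u \<in> Y. \<forall>v \<in> Y. (u, v) \<in> parcs G \<longrightarrow> c u \<noteq> c v"
    using assms(1) unfolding colourable_def by blast
  then show ?thesis
    using assms(2,3) by (intro colourableI[of _ c]) (auto intro: less_le_trans)
qed

lemma colourable_card:
  assumes "finite X" and "\<And>v. (v, v) \<notin> parcs G"
  shows "colourable G X (card X)"
proof -
  obtain c where c: "bij_betw c X {0..<card X}"
    using ex_bij_betw_finite_nat[OF assms(1)] by blast
  show ?thesis
  proof (rule colourableI)
    show "c v < card X" if "v \<in> X" for v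
      using bij_betwE[OF c] that by auto
    show "c u \<noteq> c v" if "u \<in> X" "v \<in> X" "(u, v) \<in> parcs G" for u v
      using bij_betw_imp_inj_on[OF c] that assms(2) by (auto dest: inj_onD)
  qed
qed

text \<open>An injective colouring exists by finiteness and looplessness, so the minimum defining
  \<open>chi\<close> is attained; monotonicity in \<open>q\<close> gives the rest.\<close>

lemma chi_le_iff_colourable:
  assumes "finite X" and "\<And>v. (v, v) \<notin> parcs G"
  shows "chi G X \<le> q \<longleftrightarrow> colourable G X q"
proof -
  have eq: "(\<exists>c. proper_colouring (with_proj G \<restriction> X) p c) \<longleftrightarrow> colourable G X p" for p
    unfolding proper_colouring_def colourable_def
    by (simp add: arcs_ends_def arc_to_ends_def induce_subgraph_def) force
  have chi: "chi G X = (LEAST p. colourable G X p)"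
    unfolding chi_def chromatic_number_def eq ..
  have "colourable G X (chi G X)"
    unfolding chi by (rule LeastI) (rule colourable_card[OF assms])
  then show ?thesis
    unfolding chi by (metis Least_le colourable_mono order_refl)
qed

section \<open>Path-decompositions and the path-chromatic number\<close>

lemma path_decompositionI:
  assumes "B \<noteq> []" and "\<And>X. X \<in> set B \<Longrightarrow> X \<subseteq> pverts G"
    and "\<And>v. v \<in> pverts G \<Longrightarrow> \<exists>t < length B. v \<in> B ! t"
    and "\<And>u v. (u, v) \<in> parcs G \<Longrightarrow> \<exists>t < length B. u \<in> B ! t \<and> v \<in> B ! t"
    and "\<And>v r s t. v \<in> pverts G \<Longrightarrow> r \<le> s \<Longrightarrow> s \<le> t \<Longrightarrow> t < length B \<Longrightarrow>
      v \<in> B ! r \<Longrightarrow> v \<in> B ! t \<Longrightarrow> v \<in> B ! s"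
  shows "path_decomposition G B"
proof -
  have "pverts G = \<Union> (set B)" using assms(2,3) nth_mem by blast
  moreover have "\<forall>X \<in> set B. X \<subseteq> pverts G" using assms(2) by blast
  moreover have "\<forall>(u, v) \<in> parcs G. \<exists>X \<in> set B. u \<in> X \<and> v \<in> X"
  proof clarify
    fix u v assume "(u, v) \<in> parcs G"
    then obtain t where "t < length B" "u \<in> B ! t" "v \<in> B ! t" using assms(4) by blast
    then show "\<exists>X \<in> set B. u \<in> X \<and> v \<in> X" using nth_mem by blast
  qed
  moreover have "\<forall>v \<in> pverts G. \<forall>r s t. r \<le> s \<and> s \<le> t \<and> t < length B \<and> v \<in> B ! r \<and> v \<in> B ! t \<longrightarrow> v \<in> B ! s"
    using assms(5) by blast
  ultimately show ?thesis
    unfolding path_decomposition_def using assms(1) by - (intro conjI)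
qed

lemma path_decompositionD:
  assumes "path_decomposition G B"
  shows "B \<noteq> []"
    and "X \<in> set B \<Longrightarrow> X \<subseteq> pverts G"
    and "v \<in> pverts G \<Longrightarrow> \<exists>X \<in> set B. v \<in> X"
    and "(u, v) \<in> parcs G \<Longrightarrow> \<exists>X \<in> set B. u \<in> X \<and> v \<in> X"
    and "v \<in> pverts G \<Longrightarrow> r \<le> s \<Longrightarrow> s \<le> t \<Longrightarrow> t < length B \<Longrightarrow> v \<in> B ! r \<Longrightarrow> v \<in> B ! t \<Longrightarrow> v \<in> B ! s"
proof -
  note B = assms[unfolded path_decomposition_def]
  show "B \<noteq> []" using B by (elim conjE)
  show "X \<in> set B \<Longrightarrow> X \<subseteq> pverts G" using B by (elim conjE) (erule (1) bspec)
  show "v \<in> pverts G \<Longrightarrow> \<exists>X \<in> set B. v \<in> X" using B by (elim conjE) (metis UnionE)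
  show "(u, v) \<in> parcs G \<Longrightarrow> \<exists>X \<in> set B. u \<in> X \<and> v \<in> X"
    using B by (elim conjE) (drule (1) bspec, simp)
  have "\<forall>v \<in> pverts G. \<forall>r s t. r \<le> s \<and> s \<le> t \<and> t < length B \<and> v \<in> B ! r \<and> v \<in> B ! t \<longrightarrow> v \<in> B ! s"
    using B by (elim conjE)
  then show "v \<in> pverts G \<Longrightarrow> r \<le> s \<Longrightarrow> s \<le> t \<Longrightarrow> t < length B \<Longrightarrow> v \<in> B ! r \<Longrightarrow> v \<in> B ! t \<Longrightarrow> v \<in> B ! s"
    by blast
qed

lemma path_decomposition_finite_bag:
  assumes "path_decomposition G B" and "finite (pverts G)" and "X \<in> set B"
  shows "finite X"
  using path_decompositionD(2)[OF assms(1,3)] assms(2) finite_subset by blast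

lemma decomposition_chromatic_number_le_iff:
  assumes "path_decomposition G B" and "finite (pverts G)" and "\<And>v. (v, v) \<notin> parcs G"
  shows "decomposition_chromatic_number G B \<le> q \<longleftrightarrow> (\<forall>X \<in> set B. colourable G X q)"
proof -
  have "B \<noteq> []" using assms(1) unfolding path_decomposition_def by blast
  then have "decomposition_chromatic_number G B \<le> q \<longleftrightarrow> (\<forall>X \<in> set B. chi G X \<le> q)"
    unfolding decomposition_chromatic_number_def by (subst Max_le_iff) auto
  then show ?thesis
    using chi_le_iff_colourable path_decomposition_finite_bag[OF assms(1,2)] assms(3) by blast
qed

lemma path_chromatic_number_le:
  assumes "path_decomposition G B"
  shows "path_chromatic_number G \<le> decomposition_chromatic_number G B"
  unfolding path_chromatic_number_def using assms by (auto intro: Least_le)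

lemma path_chromatic_number_leI:
  assumes "path_decomposition G B" and "finite (pverts G)" and "\<And>v. (v, v) \<notin> parcs G"
    and "\<And>X. X \<in> set B \<Longrightarrow> colourable G X q"
  shows "path_chromatic_number G \<le> q"
  using path_chromatic_number_le[OF assms(1)]
    decomposition_chromatic_number_le_iff[OF assms(1-3), of q] assms(4) by fastforce

lemma optimal_path_decomposition:
  fixes G :: "'a pair_pre_digraph"
  assumes "pair_wf_digraph G" and "finite (pverts G)" and "\<And>v. (v, v) \<notin> parcs G"
  obtains B where "path_decomposition G B"
    and "\<And>X. X \<in> set B \<Longrightarrow> colourable G X (path_chromatic_number G)"
proof -
  \<comment> \<open>The one-bag decomposition shows that the minimum defining
    \<open>path_chromatic_number\<close> is over a nonempty set.\<close>
  have "path_decomposition G [pverts G]"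
    unfolding path_decomposition_def
    by (auto dest: pair_wf_digraph.in_arcsD1[OF assms(1)] pair_wf_digraph.in_arcsD2[OF assms(1)])
  then have "\<exists>B. path_decomposition G B \<and>
      decomposition_chromatic_number G B = path_chromatic_number G"
    unfolding path_chromatic_number_def
    by (intro LeastI[of "\<lambda>q. \<exists>B. path_decomposition G B \<and> decomposition_chromatic_number G B = q"])
       blast
  then show ?thesis
    using that decomposition_chromatic_number_le_iff[OF _ assms(2,3)] by (metis order_refl)
qed

lemma path_decomposition_vimage:
  assumes "path_decomposition H B"
    and verts: "\<And>v. v \<in> pverts G \<Longrightarrow> f v \<in> pverts H"
    and arcs: "\<And>u v. (u, v) \<in> parcs G \<Longrightarrow> u \<in> pverts G \<and> v \<in> pverts G \<and> (f u, f v) \<in> parcs H"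
  shows "path_decomposition G (map (\<lambda>X. {v \<in> pverts G. f v \<in> X}) B)"
proof -
  note B = path_decompositionD[OF assms(1)]
  have "\<exists>X \<in> set B. f v \<in> X" if "v \<in> pverts G" for v
    using B(3)[OF verts[OF that]] .
  moreover have "\<exists>X \<in> set B. f u \<in> X \<and> f v \<in> X" if "(u, v) \<in> parcs G" for u v
    using B(4) arcs[OF that] by blast
  moreover have "f v \<in> B ! s"
    if "v \<in> pverts G" "r \<le> s" "s \<le> t" "t < length B" "f v \<in> B ! r" "f v \<in> B ! t" for v r s t
    using B(5)[OF verts[OF that(1)] that(2-)] .
  moreover note B(1)
  ultimately show ?thesis
    unfolding path_decomposition_def using arcs by (auto 0 3)
qed

text \<open>Pull the bags of an optimal decomposition of \<open>H\<close> back along the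
  homomorphism \<open>f\<close>; composing with \<open>f\<close> turns colourings of bags into
  colourings of their preimages.\<close>

lemma path_chromatic_number_hom:
  assumes "pair_wf_digraph H" and "finite (pverts H)" and "\<And>v. (v, v) \<notin> parcs H"
    and "finite (pverts G)"
    and verts: "\<And>v. v \<in> pverts G \<Longrightarrow> f v \<in> pverts H"
    and arcs: "\<And>u v. (u, v) \<in> parcs G \<Longrightarrow> u \<in> pverts G \<and> v \<in> pverts G \<and> (f u, f v) \<in> parcs H"
  shows "path_chromatic_number G \<le> path_chromatic_number H"
proof -
  obtain B where B: "path_decomposition H B"
    and col: "\<And>X. X \<in> set B \<Longrightarrow> colourable H X (path_chromatic_number H)"
    using optimal_path_decomposition[OF assms(1-3)] by blast
  show ?thesis
  proof (rule path_chromatic_number_leI[OF path_decomposition_vimage[OF B]])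
    show "colourable G X (path_chromatic_number H)"
      if X: "X \<in> set (map (\<lambda>X. {v \<in> pverts G. f v \<in> X}) B)" for X
    proof -
      obtain Y where Y: "Y \<in> set B" "X = {v \<in> pverts G. f v \<in> Y}" using X by auto
      obtain c where "\<forall>v \<in> Y. c v < path_chromatic_number H"
        "\<forall>u \<in> Y. \<forall>v \<in> Y. (u, v) \<in> parcs H \<longrightarrow> c u \<noteq> c v"
        using col[OF Y(1)] unfolding colourable_def by blast
      then show ?thesis
        using Y(2) arcs by (intro colourableI[of _ "c \<circ> f"]) auto
    qed
    show "(v, v) \<notin> parcs G" for v using arcs assms(3) by blast
  qed (use assms in auto)
qed

section \<open>Interval form of a path-decomposition\<close>

text \<open>The bags containing \<open>x\<close> are consecutive, so their least and greatest
  indices determine them. Adjacent vertices share a bag, which for intervals is the pair of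
  inequalities in the last clause.\<close>

lemma path_decomposition_intervals:
  assumes "path_decomposition H B"
  obtains l r where "\<And>x. x \<in> pverts H \<Longrightarrow> l x \<le> r x"
    and "\<And>x. x \<in> pverts H \<Longrightarrow> r x < length B"
    and "\<And>x t. x \<in> pverts H \<Longrightarrow> l x \<le> t \<Longrightarrow> t \<le> r x \<Longrightarrow> x \<in> B ! t"
    and "\<And>x y. (x, y) \<in> parcs H \<Longrightarrow> l x \<le> r y \<and> l y \<le> r x"
proof -
  note B = path_decompositionD[OF assms]
  define T where "T x = {t. t < length B \<and> x \<in> B ! t}" for x
  have fin: "finite (T x)" for x unfolding T_def by simp
  have ne: "T x \<noteq> {}" if "x \<in> pverts H" for x
    using B(3)[OF that] unfolding T_def by (auto simp: in_set_conv_nth)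
  have mem: "Min (T x) \<in> T x" "Max (T x) \<in> T x" if "x \<in> pverts H" for x
    using fin ne[OF that] by auto
  show ?thesis
  proof (rule that[of "\<lambda>x. Min (T x)" "\<lambda>x. Max (T x)"])
    fix x assume x: "x \<in> pverts H"
    show "Min (T x) \<le> Max (T x)" using mem[OF x] fin by simp
    show "Max (T x) < length B" using mem[OF x] unfolding T_def by simp
    show "x \<in> B ! t" if "Min (T x) \<le> t" "t \<le> Max (T x)" for t
    proof -
      have "x \<in> B ! Min (T x)" "x \<in> B ! Max (T x)" "Max (T x) < length B"
        using mem[OF x] unfolding T_def by auto
      then show ?thesis using B(5)[OF x that] by blast
    qed
  next
    fix x y assume "(x, y) \<in> parcs H"
    then obtain X where "X \<in> set B" "x \<in> X" "y \<in> X" using B(4) by blast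
    then have "\<exists>t. t \<in> T x \<and> t \<in> T y" unfolding T_def by (auto simp: in_set_conv_nth)
    then obtain t where "t \<in> T x" "t \<in> T y" by blast
    then show "Min (T x) \<le> Max (T y) \<and> Min (T y) \<le> Max (T x)"
      using fin by (meson Max_ge Min_le order_trans)
  qed
qed

text \<open>
  The copy \<open>(i, v)\<close> occupies the bags \<open>l i v, \<dots>, r i v\<close> and has colour \<open>col t i v\<close> in bag \<open>t\<close>;
  \<open>lc\<close>, \<open>rc\<close> and \<open>cc\<close> play the same roles for the centre of layer \<open>i\<close>.
\<close>

locale layered_intervals =
  fixes V :: "'a set" and E :: "('a \<times> 'a) set" and m k :: nat
    and l r :: "nat \<Rightarrow> 'a \<Rightarrow> nat" and lc rc :: "nat \<Rightarrow> nat"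
    and col :: "nat \<Rightarrow> nat \<Rightarrow> 'a \<Rightarrow> nat" and cc :: "nat \<Rightarrow> nat \<Rightarrow> nat"
  assumes finite_V: "finite V"
    and sym_E: "(u, v) \<in> E \<Longrightarrow> (v, u) \<in> E"
    and irrefl_E: "(v, v) \<notin> E"
    and E_verts: "(u, v) \<in> E \<Longrightarrow> u \<in> V"
    and k_pos: "1 \<le> k"
    and many_layers: "card V + k + 2 \<le> m"
    and l_le_r: "i \<in> {1..m} \<Longrightarrow> v \<in> V \<Longrightarrow> l i v \<le> r i v"
    and lc_le_rc: "i \<in> {1..m} \<Longrightarrow> lc i \<le> rc i"
    and star: "i \<in> {1..m} \<Longrightarrow> v \<in> V \<Longrightarrow> l i v \<le> rc i \<and> lc i \<le> r i v"
    and cross: "i \<in> {1..m} \<Longrightarrow> j \<in> {1..m} \<Longrightarrow> i \<noteq> j \<Longrightarrow> (u, v) \<in> E \<Longrightarrow> l i u \<le> r j v"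
    and col_less: "i \<in> {1..m} \<Longrightarrow> v \<in> V \<Longrightarrow> l i v \<le> t \<Longrightarrow> t \<le> r i v \<Longrightarrow> col t i v < k"
    and cc_less: "i \<in> {1..m} \<Longrightarrow> lc i \<le> t \<Longrightarrow> t \<le> rc i \<Longrightarrow> cc t i < k"
    and col_cross: "i \<in> {1..m} \<Longrightarrow> j \<in> {1..m} \<Longrightarrow> i \<noteq> j \<Longrightarrow> (u, v) \<in> E \<Longrightarrow>
      l i u \<le> t \<Longrightarrow> t \<le> r i u \<Longrightarrow> l j v \<le> t \<Longrightarrow> t \<le> r j v \<Longrightarrow> col t i u \<noteq> col t j v"
    and col_star: "i \<in> {1..m} \<Longrightarrow> v \<in> V \<Longrightarrow> l i v \<le> t \<Longrightarrow> t \<le> r i v \<Longrightarrow>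
      lc i \<le> t \<Longrightarrow> t \<le> rc i \<Longrightarrow> col t i v \<noteq> cc t i"
begin

abbreviation G :: "'a pair_pre_digraph" where
  "G \<equiv> \<lparr>pverts = V, parcs = E\<rparr>"

section \<open>Repeated colours within one bag\<close>

definition alive :: "nat \<Rightarrow> nat \<Rightarrow> 'a \<Rightarrow> bool" where
  "alive t i v \<longleftrightarrow> i \<in> {1..m} \<and> v \<in> V \<and> l i v \<le> t \<and> t \<le> r i v"

definition repeated :: "nat \<Rightarrow> 'a \<Rightarrow> nat \<Rightarrow> bool" where
  "repeated t v q \<longleftrightarrow> (\<exists>i j. i \<noteq> j \<and> alive t i v \<and> alive t j v \<and> col t i v = q \<and> col t j v = q)"

lemma alive_col_less: "alive t i v \<Longrightarrow> col t i v < k"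
  unfolding alive_def using col_less by blast

lemma repeated_less: "repeated t v q \<Longrightarrow> q < k"
  unfolding repeated_def using alive_col_less by blast

lemma repeated_exists:
  assumes "k + 1 \<le> card L" and "\<And>i. i \<in> L \<Longrightarrow> alive t i v"
  shows "\<exists>q. repeated t v q"
proof -
  have "card ((\<lambda>i. col t i v) ` L) \<le> card {..<k}"
    using assms alive_col_less by (intro card_mono) auto
  then have "card ((\<lambda>i. col t i v) ` L) < card L" using assms(1) by simp
  then have "\<not> inj_on (\<lambda>i. col t i v) L" using pigeonhole by blast
  then show ?thesis using assms(2) unfolding repeated_def inj_on_def by metis
qed

text \<open>At least one of the two copies of \<open>v\<close> that carry \<open>q\<close> lies
  outside layer \<open>i\<close>, hence is adjacent to the copy of \<open>u\<close> in layer
  \<open>i\<close>.\<close>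

lemma col_neq_repeated:
  assumes "(u, v) \<in> E" and "alive t i u" and "repeated t v q"
  shows "col t i u \<noteq> q"
proof -
  obtain j j' where j: "j \<noteq> j'" "alive t j v" "alive t j' v" "col t j v = q" "col t j' v = q"
    using assms(3) unfolding repeated_def by blast
  have "col t i u \<noteq> col t j'' v" if "alive t j'' v" "i \<noteq> j''" for j''
    using that assms(1,2) col_cross[of i j'' u v t] unfolding alive_def by blast
  then show ?thesis using j by metis
qed

text \<open>Give every vertex a repeated colour, except \<open>v\<close>, which takes the colour of
  a single alive copy. Each edge then has an end with a repeated colour, while the other end has the
  colour of some alive copy, so \<open>col_neq_repeated\<close> separates them.\<close>

lemma colourable_insert:
  assumes "\<And>w. w \<in> X \<Longrightarrow> w \<noteq> v \<Longrightarrow> \<exists>q. repeated t w q" and "alive t i v"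
  shows "colourable G X k"
proof (rule colourableI)
  let ?c = "\<lambda>w. if w = v then col t i v else SOME q. repeated t w q"
  have rep: "repeated t w (?c w)" if "w \<in> X" "w \<noteq> v" for w
    using someI_ex[OF assms(1)[OF that]] that by simp
  show "?c w < k" if "w \<in> X" for w
    using rep[OF that] repeated_less alive_col_less[OF assms(2)] by (cases "w = v") auto
  show "?c u \<noteq> ?c w" if uX: "u \<in> X" and "w \<in> X" "(u, w) \<in> parcs G" for u w
  proof -
    have uw: "(u, w) \<in> E" "(w, u) \<in> E" "u \<noteq> w" using that sym_E irrefl_E by auto
    consider "u = v" "w \<noteq> v" | "w = v" "u \<noteq> v" | "u \<noteq> v" "w \<noteq> v" using uw(3) by blast
    then show ?thesis
    proof cases
      case 1
      then show ?thesis using col_neq_repeated[OF uw(1) _ rep[OF that(2) 1(2)], of i] assms(2) by simp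
    next
      case 2
      then show ?thesis using col_neq_repeated[OF uw(2) _ rep[OF that(1) 2(2)], of i] assms(2) by simp
    next
      case 3
      obtain j where "alive t j u" "col t j u = ?c u"
        using rep[OF uX 3(1)] unfolding repeated_def by blast
      then show ?thesis using col_neq_repeated[OF uw(1) _ rep[OF that(2) 3(2)]] by metis
    qed
  qed
qed

text \<open>If every vertex had an alive copy coloured differently from \<open>a\<close>, the
  vertices whose chosen repeated colour is \<open>a\<close> could switch to the colour of such a
  copy. The resulting proper colouring avoids \<open>a\<close> and so uses only \<open>k - 1\<close>
  colours.\<close>

lemma stubborn_vertex:
  assumes rep: "\<And>w. w \<in> X \<Longrightarrow> \<exists>q. repeated t w q"
    and "\<not> colourable G X (k - 1)" and "a < k"
  shows "\<exists>w \<in> X. \<forall>i. alive t i w \<longrightarrow> col t i w = a"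
proof (rule ccontr)
  assume "\<not> ?thesis"
  then have "\<exists>i. alive t i w \<and> col t i w \<noteq> a" if "w \<in> X" for w using that by blast
  then obtain f where f: "\<And>w. w \<in> X \<Longrightarrow> alive t (f w) w \<and> col t (f w) w \<noteq> a" by metis
  obtain \<phi> where \<phi>: "\<And>w. w \<in> X \<Longrightarrow> repeated t w (\<phi> w)" using rep by metis
  define \<psi> where "\<psi> w = (if \<phi> w = a then col t (f w) w else \<phi> w)" for w
  have \<psi>: "\<psi> w < k" "\<psi> w \<noteq> a" if "w \<in> X" for w
    using f[OF that] repeated_less[OF \<phi>[OF that]] alive_col_less unfolding \<psi>_def by auto
  have proper: "\<psi> u \<noteq> \<psi> w" if "u \<in> X" "w \<in> X" "(u, w) \<in> E" for u w
  proof -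
    have some: "\<exists>j. alive t j x \<and> col t j x = \<psi> x" if "x \<in> X" for x
      using f[OF that] \<phi>[OF that] unfolding \<psi>_def repeated_def by auto
    have "(w, u) \<in> E" using that sym_E by blast
    \<comment> \<open>Hence at most one end of an edge is recoloured, and the other keeps a repeated
      colour.\<close>
    moreover have "\<phi> u \<noteq> a \<or> \<phi> w \<noteq> a"
    proof (rule ccontr)
      assume "\<not> (\<phi> u \<noteq> a \<or> \<phi> w \<noteq> a)"
      then have "repeated t u a" "repeated t w a" using \<phi>[OF that(1)] \<phi>[OF that(2)] by auto
      then show False using col_neq_repeated[OF that(3)] unfolding repeated_def by blast
    qed
    ultimately show ?thesis
      using some[OF that(1)] some[OF that(2)] \<phi>[OF that(1)] \<phi>[OF that(2)]
        col_neq_repeated[OF that(3)] col_neq_repeated[of w u] unfolding \<psi>_def by metis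
  qed
  have "colourable G X (k - 1)"
  \<comment> \<open>Colour \<open>k - 1\<close> is renamed to the free colour \<open>a\<close>, so
    that the colours used lie below \<open>k - 1\<close>.\<close>
  proof (rule colourableI[of _ "\<lambda>w. if \<psi> w = k - 1 then a else \<psi> w"])
    show "(if \<psi> w = k - 1 then a else \<psi> w) < k - 1" if "w \<in> X" for w
      using \<psi>[OF that] assms(3) by (auto split: if_splits)
    show "(if \<psi> u = k - 1 then a else \<psi> u) \<noteq> (if \<psi> w = k - 1 then a else \<psi> w)"
      if "u \<in> X" "w \<in> X" "(u, w) \<in> parcs G" for u w
      using \<psi>[OF that(1)] \<psi>[OF that(2)] proper[of u w] that by (auto split: if_splits)
  qed
  with assms(2) show False by blast
qed

text \<open>Otherwise some vertex of \<open>X\<close> is stubborn for the colour of centre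
  \<open>i\<close>; its copy in layer \<open>i\<close> is alive and adjacent to that centre, yet has
  the same colour.\<close>

lemma colourable_full_layer:
  assumes "i \<in> {1..m}" and "lc i \<le> t" and "t \<le> rc i"
    and "k + 1 \<le> card L" and "\<And>j w. w \<in> X \<Longrightarrow> j \<in> L \<Longrightarrow> alive t j w" and "i \<in> L"
  shows "colourable G X (k - 1)"
proof (rule ccontr)
  assume "\<not> ?thesis"
  moreover have "\<exists>q. repeated t w q" if "w \<in> X" for w
    using repeated_exists[OF assms(4)] assms(5)[OF that] by blast
  ultimately obtain w where w: "w \<in> X" "\<forall>j. alive t j w \<longrightarrow> col t j w = cc t i"
    using stubborn_vertex[of X t "cc t i"] cc_less[OF assms(1-3)] by blast
  then have "alive t i w" using assms(5,6) by blast
  then show False using w col_star[OF assms(1) _ _ _ assms(2,3)] unfolding alive_def by blast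
qed

section \<open>First ends of the copies of a vertex\<close>

definition first_end :: "'a \<Rightarrow> nat" where
  "first_end v = Min ((\<lambda>i. r i v) ` {1..m})"

lemma first_end_le: "i \<in> {1..m} \<Longrightarrow> first_end v \<le> r i v"
  unfolding first_end_def by simp

lemma first_end_obtain:
  obtains i where "i \<in> {1..m}" and "r i v = first_end v"
proof -
  have "{1..m} \<noteq> {}" using many_layers by simp
  then have "first_end v \<in> (\<lambda>i. r i v) ` {1..m}"
    unfolding first_end_def by (intro Min_in) auto
  then show ?thesis using that by auto
qed

text \<open>No copy of \<open>w\<close> has ended before \<open>t\<close>. The first copy of
  \<open>u\<close> to end, in layer \<open>j\<close>, ends by \<open>t\<close> and must be met by
  every copy of \<open>w\<close> outside layer \<open>j\<close>. So at least \<open>m - 1\<close>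
  copies of \<open>w\<close> are alive, more than \<open>k\<close>.\<close>

lemma repeated_after_neighbour:
  assumes "(u, w) \<in> E" and "first_end u \<le> t" and "t \<le> first_end w"
  shows "\<exists>q. repeated t w q"
proof -
  obtain j where j: "j \<in> {1..m}" "r j u = first_end u" by (rule first_end_obtain)
  have wu: "(w, u) \<in> E" "w \<in> V" using assms(1) sym_E E_verts by auto
  have "alive t i w" if "i \<in> {1..m} - {j}" for i
    using that cross[OF _ j(1) _ wu(1), of i] j(2) assms(2,3) wu(2) first_end_le[of i w]
    unfolding alive_def by auto
  moreover have "k + 1 \<le> card ({1..m} - {j})" using j(1) many_layers by simp
  ultimately show ?thesis using repeated_exists by blast
qed

text \<open>
  Each active centre \<open>i\<close> meets a vertex whose copy in layer \<open>i\<close> has not started; a neighbour of it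
  in \<open>P\<close> has ended in layer \<open>i\<close> and in no other layer, so distinct centres use up distinct
  vertices of \<open>P\<close>.
\<close>

lemma colourable_many_active:
  assumes PV: "P \<subseteq> V" and XV: "X \<subseteq> V" and disj: "card (P \<inter> X) \<le> 1"
    and P: "\<And>u. u \<in> P \<Longrightarrow> first_end u \<le> t"
    and X: "\<And>w. w \<in> X \<Longrightarrow> t \<le> first_end w \<and> (\<exists>u \<in> P. (u, w) \<in> E)"
    and active: "m \<le> card {i \<in> {1..m}. lc i \<le> t \<and> t \<le> rc i} + 2 * k"
  shows "colourable G X (k - 1)"
proof (rule ccontr)
  assume nc: "\<not> ?thesis"
  let ?A = "{i \<in> {1..m}. lc i \<le> t \<and> t \<le> rc i}"
  have fin: "finite P" "finite X" using PV XV finite_V finite_subset by auto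
  have "\<exists>q. repeated t w q" if "w \<in> X" for w
    using X[OF that] P repeated_after_neighbour by blast
  note stub = stubborn_vertex[OF this nc]
  have ex: "\<exists>u \<in> P. \<exists>w \<in> X. (u, w) \<in> E \<and> t < l i w \<and> r i u \<le> t" if i: "i \<in> ?A" for i
  proof -
    \<comment> \<open>A vertex stubborn for the colour of centre \<open>i\<close> has no alive copy
      in layer \<open>i\<close>; since none of its copies ends before \<open>t\<close>, that copy
      has not started.\<close>
    have "cc t i < k" using cc_less i by auto
    then obtain w where w: "w \<in> X" "\<forall>j. alive t j w \<longrightarrow> col t j w = cc t i"
      using stub by blast
    then have "\<not> alive t i w"
      using col_star[of i w t] i unfolding alive_def by auto
    then have lw: "t < l i w"
      using i w(1) XV X[OF w(1)] first_end_le[of i w] unfolding alive_def by fastforce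
    obtain u where u: "u \<in> P" "(u, w) \<in> E" using X[OF w(1)] by blast
    \<comment> \<open>If \<open>j\<close> were another layer, the copy of \<open>w\<close> in layer
      \<open>i\<close> would have to start before this copy of \<open>u\<close> ends, that is, by
      \<open>t\<close>.\<close>
    obtain j where j: "j \<in> {1..m}" "r j u = first_end u" by (rule first_end_obtain)
    have "i = j"
      using cross[of i j w u] i j u sym_E P[OF u(1)] lw by fastforce
    then have "r i u \<le> t" using j P[OF u(1)] by simp
    then show ?thesis using u w(1) lw by blast
  qed
  then obtain g where g: "\<And>i. i \<in> ?A \<Longrightarrow> g i \<in> P \<and> (\<exists>w \<in> X. (g i, w) \<in> E \<and> t < l i w \<and> r i (g i) \<le> t)"
    by metis
  have "inj_on g ?A"
  proof (rule inj_onI, rule ccontr)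
    fix i j assume ij: "i \<in> ?A" "j \<in> ?A" "g i = g j" "i \<noteq> j"
    obtain w where w: "(g i, w) \<in> E" "t < l i w" using g[OF ij(1)] by blast
    have "l i w \<le> r j (g j)" using cross[of i j w "g j"] ij w sym_E by auto
    moreover have "r j (g j) \<le> t" using g[OF ij(2)] by blast
    ultimately show False using w(2) by simp
  qed
  moreover have "g ` ?A \<subseteq> P" using g by auto
  ultimately have "card ?A \<le> card P" using card_inj_on_le fin(1) by blast
  \<comment> \<open>A set of fewer than \<open>k\<close> vertices is coloured injectively with
    \<open>k - 1\<close> colours.\<close>
  moreover have "k \<le> card X"
  proof (rule ccontr)
    assume "\<not> ?thesis"
    then have "card X \<le> k - 1" by simp
    with nc show False
      using colourable_mono[OF colourable_card[OF fin(2), of G]] irrefl_E by auto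
  qed
  moreover have "card P + card X \<le> card V + 1"
    using card_Un_Int[OF fin] disj card_mono[OF finite_V, of "P \<union> X"] PV XV by simp
  \<comment> \<open>Together: \<open>m <= card P + 2 * k\<close> and
    \<open>card P <= card V + 1 - k\<close>, so \<open>m <= card V + k + 1\<close>, one less than
    \<open>many_layers\<close> demands.\<close>
  ultimately show False using active many_layers by linarith
qed

section \<open>Thresholds among the centres and the sorting key\<close>

text \<open>\<open>a\<close> is the \<open>(k + 1)\<close>-st largest start of a centre, counted
  with multiplicity. From bag \<open>a\<close> on, at most \<open>k\<close> centres have not
  started.\<close>

lemma last_start_threshold:
  obtains a i where "i \<in> {1..m}" and "lc i = a"
    and "k + 1 \<le> card {i \<in> {1..m}. a \<le> lc i}" and "card {i \<in> {1..m}. a < lc i} \<le> k"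
proof -
  let ?N = "\<lambda>t. {i \<in> {1..m}. t \<le> lc i}"
  let ?T = "{t. k + 1 \<le> card (?N t)}"
  have "?T \<subseteq> {..Max (lc ` {1..m})}"
  proof
    fix t assume "t \<in> ?T"
    then have "k + 1 \<le> card (?N t)" by (rule CollectD)
    then have "card (?N t) \<noteq> 0" by linarith
    then have "?N t \<noteq> {}" by (metis card.empty)
    then obtain i where "i \<in> {1..m}" "t \<le> lc i" by blast
    then show "t \<in> {..Max (lc ` {1..m})}" by (auto intro: order_trans Max_ge)
  qed
  then have fin: "finite ?T" using finite_subset by blast
  have "?N 0 = {1..m}" by auto
  then have "card (?N 0) = m" by (metis card_atLeastAtMost diff_Suc_1)
  then have "0 \<in> ?T" using many_layers by (simp only: mem_Collect_eq)
  then have a: "Max ?T \<in> ?T" using fin Max_in by blast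
  have "Suc (Max ?T) \<notin> ?T" using Max_ge[OF fin] Suc_n_not_le_n by blast
  moreover have "?N (Suc (Max ?T)) = {i \<in> {1..m}. Max ?T < lc i}" by auto
  ultimately have less: "card {i \<in> {1..m}. Max ?T < lc i} \<le> k" by simp
  \<comment> \<open>Without a centre starting exactly at the maximum, the strict and the weak count
    would agree, although one is at most \<open>k\<close> and the other at least
    \<open>k + 1\<close>.\<close>
  have "\<exists>i \<in> {1..m}. lc i = Max ?T"
  proof (rule ccontr)
    assume "\<not> ?thesis"
    then have "{i \<in> {1..m}. Max ?T < lc i} = ?N (Max ?T)" by (auto simp: le_less)
    then show False using less a by simp
  qed
  then show ?thesis using that a less by auto
qed

text \<open>The mirror image: \<open>b\<close> is the \<open>(k + 1)\<close>-st smallest end of a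
  centre, so up to bag \<open>b\<close> at most \<open>k\<close> centres have ended.\<close>

lemma first_stop_threshold:
  obtains b i where "i \<in> {1..m}" and "rc i = b"
    and "k + 1 \<le> card {i \<in> {1..m}. rc i \<le> b}" and "card {i \<in> {1..m}. rc i < b} \<le> k"
proof -
  let ?D = "\<lambda>t. {i \<in> {1..m}. rc i \<le> t}"
  define b where "b = (LEAST t. k + 1 \<le> card (?D t))"
  have "?D (Max (rc ` {1..m})) = {1..m}" by auto
  then have "k + 1 \<le> card (?D (Max (rc ` {1..m})))" using many_layers by simp
  then have b: "k + 1 \<le> card (?D b)" unfolding b_def by (rule LeastI)
  have less: "card {i \<in> {1..m}. rc i < b} \<le> k"
  proof (cases b)
    case (Suc b')
    then have "\<not> k + 1 \<le> card (?D b')" unfolding b_def by (intro not_less_Least) simp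
    moreover have "?D b' = {i \<in> {1..m}. rc i < b}" using Suc by auto
    ultimately show ?thesis by simp
  qed simp
  have "\<exists>i \<in> {1..m}. rc i = b"
  proof (rule ccontr)
    assume "\<not> ?thesis"
    then have "{i \<in> {1..m}. rc i < b} = ?D b" by (auto simp: le_less)
    then show False using less b by simp
  qed
  then show ?thesis using that b less by auto
qed

text \<open>For an enumeration sorted by \<open>key\<close>, with ties broken in any way,
  \<open>P\<close> is the set of vertices before \<open>v\<close> and \<open>X\<close> is the bag of
  \<open>v\<close>. The conclusion is the bag condition of a special enumeration, with
  \<open>k\<close> as path-chromatic number.\<close>

lemma special_sort_key:
  obtains key :: "'a \<Rightarrow> nat" where
    "\<And>P v X. P \<subseteq> V \<Longrightarrow> v \<in> V - P \<Longrightarrow> (\<And>u. u \<in> P \<Longrightarrow> key u \<le> key v) \<Longrightarrow>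
       (\<And>w. w \<in> V - P \<Longrightarrow> key v \<le> key w) \<Longrightarrow>
       X = {w \<in> V - P. w = v \<or> (\<exists>u \<in> insert v P. (u, w) \<in> E)} \<Longrightarrow>
       colourable G X (k - 1) \<or> colourable G X k \<and> (\<forall>u \<in> P. (u, v) \<notin> E)"
proof -
  obtain a ia where ia: "ia \<in> {1..m}" "lc ia = a"
    and a: "k + 1 \<le> card {i \<in> {1..m}. a \<le> lc i}" "card {i \<in> {1..m}. a < lc i} \<le> k"
    by (rule last_start_threshold)
  obtain b ib where ib: "ib \<in> {1..m}" "rc ib = b"
    and b: "k + 1 \<le> card {i \<in> {1..m}. rc i \<le> b}" "card {i \<in> {1..m}. rc i < b} \<le> k"
    by (rule first_stop_threshold)
  define S where "S = {v \<in> V. first_end v < a}"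
  define NS where "NS = {w \<in> V. \<exists>u \<in> S. (u, w) \<in> E}"
  \<comment> \<open>Look at bag \<open>a\<close> and a layer whose centre starts at \<open>a\<close>
    or later. A copy ending before \<open>a\<close> cannot lie in it, so the copy of
    \<open>w\<close> there meets the ended copy of \<open>u\<close> and has started; meeting its own
    late centre, it has not ended before \<open>a\<close>.\<close>
  have NS: "colourable G NS (k - 1)"
  proof (rule colourable_full_layer[OF ia(1) _ _ a(1)])
    show "alive a j w" if w: "w \<in> NS" and j: "j \<in> {i \<in> {1..m}. a \<le> lc i}" for j w
    proof -
      obtain u where u: "u \<in> V" "first_end u < a" "(u, w) \<in> E" "w \<in> V"
        using w unfolding NS_def S_def by blast
      obtain j' where j': "j' \<in> {1..m}" "r j' u = first_end u" by (rule first_end_obtain)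
      have "j \<noteq> j'" using star[OF j'(1) u(1)] j' u(2) j by auto
      then have "l j w \<le> a" using cross[of j j' w u] j j' u sym_E by fastforce
      moreover have "a \<le> r j w" using star[of j w] u(4) j by auto
      ultimately show ?thesis using u(4) j unfolding alive_def by blast
    qed
  qed (use ia lc_le_rc[OF ia(1)] in auto)
  \<comment> \<open>In bag \<open>b\<close>, for each layer whose centre has ended by
    \<open>b\<close>, these vertices have started because they meet the centre, and they all end
    after \<open>b\<close>.\<close>
  have late: "colourable G {w \<in> V. b < first_end w} (k - 1)"
  proof (rule colourable_full_layer[OF ib(1) _ _ b(1)])
    show "alive b j w" if "w \<in> {w \<in> V. b < first_end w}" "j \<in> {i \<in> {1..m}. rc i \<le> b}" for j w
      using that star[of j w] first_end_le[of j w] unfolding alive_def by fastforce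
  qed (use ib lc_le_rc[OF ib(1)] in auto)
  \<comment> \<open>This puts \<open>S \<inter> NS\<close> after the rest of \<open>S\<close> (keys at most \<open>2 * a - 2\<close>) and before the
    vertices outside \<open>S\<close> (keys at least \<open>2 * a\<close>).\<close>
  define key where "key v = (if v \<in> S \<inter> NS then 2 * a - 1 else 2 * first_end v)" for v
  show ?thesis
  proof (rule that[of key])
    fix P v X
    assume PV: "P \<subseteq> V" and v: "v \<in> V - P"
      and le: "\<And>u. u \<in> P \<Longrightarrow> key u \<le> key v" and ge: "\<And>w. w \<in> V - P \<Longrightarrow> key v \<le> key w"
      and X: "X = {w \<in> V - P. w = v \<or> (\<exists>u \<in> insert v P. (u, w) \<in> E)}"
    let ?p = "first_end v"
    obtain iv where iv: "iv \<in> {1..m}" "r iv v = ?p" by (rule first_end_obtain)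
    have alive_v: "alive ?p iv v"
      using iv v l_le_r[of iv v] unfolding alive_def by auto
    \<comment> \<open>Every vertex of the bag other than \<open>v\<close> has a neighbour in
      \<open>insert v P\<close> and so a repeated colour at \<open>?p\<close>; the copy of
      \<open>v\<close> ending at \<open>?p\<close> supplies the colour of \<open>v\<close>.\<close>
    have separated: "colourable G X k"
      if nbr: "\<And>u w. u \<in> insert v P \<Longrightarrow> w \<in> X \<Longrightarrow> (u, w) \<in> E \<Longrightarrow> first_end u \<le> ?p \<and> ?p \<le> first_end w"
    proof (rule colourable_insert[OF _ alive_v])
      show "\<exists>q. repeated ?p w q" if w: "w \<in> X" "w \<noteq> v" for w
        using w nbr[OF _ w(1)] repeated_after_neighbour unfolding X by blast
    qed
    consider "v \<in> S - NS" | "v \<in> S \<inter> NS" | "v \<notin> S" by blast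
    then show "colourable G X (k - 1) \<or> colourable G X k \<and> (\<forall>u \<in> P. (u, v) \<notin> E)"
    proof cases
      case 1
      then have kv: "key v = 2 * ?p" "?p < a" unfolding key_def S_def by auto
      have P: "u \<in> S - NS \<and> first_end u \<le> ?p" if "u \<in> insert v P" for u
      proof (cases "u = v")
        case False
        then have u: "u \<in> P" using that by simp
        then have "key u \<le> 2 * ?p" "u \<in> V" using le kv PV by auto
        then show ?thesis using kv(2) unfolding key_def S_def by (auto split: if_splits)
      qed (use 1 in simp)
      have "first_end u \<le> ?p \<and> ?p \<le> first_end w"
        if "u \<in> insert v P" "w \<in> X" "(u, w) \<in> E" for u w
      proof -
        have "w \<in> V" using that(2) X v by auto
        \<comment> \<open>Otherwise \<open>u\<close> would be a neighbour of a vertex of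
          \<open>S\<close> and so belong to \<open>NS\<close>.\<close>
        moreover have "w \<notin> S"
          using P[OF that(1)] that(3) sym_E E_verts unfolding NS_def by blast
        ultimately show ?thesis using P[OF that(1)] kv(2) unfolding S_def by auto
      qed
      moreover have "\<forall>u \<in> P. (u, v) \<notin> E"
        using P 1 unfolding NS_def S_def by blast
      ultimately show ?thesis using separated by blast
    next
      case 2
      have "u \<in> S" if "u \<in> insert v P" for u
      proof (cases "u = v")
        case False
        then have u: "u \<in> P" using that by simp
        then have "key u \<le> 2 * a - 1" "u \<in> V" using le[OF u] 2 PV unfolding key_def by auto
        \<comment> \<open>For \<open>a = 0\<close>, truncated subtraction would make
          \<open>2 * a - 1\<close> equal to \<open>2 * a\<close>, and the key would no longer
          separate \<open>S\<close> from its complement.\<close>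
        moreover have "0 < a" using 2 unfolding S_def by simp
        ultimately show ?thesis unfolding key_def S_def by (auto split: if_splits)
      qed (use 2 in simp)
      then have "X \<subseteq> NS" using 2 unfolding X NS_def by blast
      then show ?thesis using colourable_mono[OF NS] by blast
    next
      case 3
      then have kv: "key v = 2 * ?p" "a \<le> ?p" using v unfolding key_def S_def by auto
      have P: "first_end u \<le> ?p" if "u \<in> insert v P" for u
      proof (cases "u = v")
        case False
        then have "key u \<le> 2 * ?p" using that le kv(1) by auto
        then show ?thesis using kv(2) unfolding key_def S_def by (auto split: if_splits)
      qed simp
      have XV: "X \<subseteq> V - P" using v unfolding X by auto
      have ge': "?p \<le> first_end w" if "w \<in> X" for w
      proof -
        have "2 * ?p \<le> key w" using ge[of w] that XV kv(1) by auto
        then show ?thesis using kv(2) unfolding key_def S_def by (auto split: if_splits)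
      qed
      show ?thesis
      proof (cases "\<forall>u \<in> P. (u, v) \<notin> E")
        case True
        then show ?thesis using separated P ge' by blast
      next
        case False
        show ?thesis
        proof (cases "?p \<le> b")
          case True
          have "colourable G X (k - 1)"
          proof (rule colourable_many_active[of "insert v P" X ?p])
            \<comment> \<open>\<open>v\<close> lies both in the closed prefix and in its own bag,
              which is why the overlap is bounded by 1 rather than empty.\<close>
            have "insert v P \<inter> X \<subseteq> {v}" using XV by auto
            then show "card (insert v P \<inter> X) \<le> 1" using card_mono[of "{v}"] by fastforce
            \<comment> \<open>For \<open>w = v\<close> the required neighbour is the earlier one,
              whose existence is the present case.\<close>
            show "?p \<le> first_end w \<and> (\<exists>u \<in> insert v P. (u, w) \<in> E)" if "w \<in> X" for w
              using that ge' False unfolding X by blast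
            let ?A = "{i \<in> {1..m}. lc i \<le> ?p \<and> ?p \<le> rc i}"
            \<comment> \<open>As \<open>a <= ?p <= b\<close>, a centre missing at \<open>?p\<close>
              either starts after \<open>a\<close> or ends before \<open>b\<close>; there are at
              most \<open>k\<close> of each sort.\<close>
            have "{1..m} \<subseteq> ?A \<union> ({i \<in> {1..m}. a < lc i} \<union> {i \<in> {1..m}. rc i < b})"
              using kv(2) True by auto
            then have "card {1..m} \<le> card (?A \<union> ({i \<in> {1..m}. a < lc i} \<union> {i \<in> {1..m}. rc i < b}))"
              by (intro card_mono) auto
            also have "\<dots> \<le> card ?A + (card {i \<in> {1..m}. a < lc i} + card {i \<in> {1..m}. rc i < b})"
              by (meson card_Un_le add_left_mono order_trans)
            finally show "m \<le> card ?A + 2 * k" using a(2) b(2) by simp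
          qed (use P PV v XV in auto)
          then show ?thesis by blast
        next
          case False
          then have "X \<subseteq> {w \<in> V. b < first_end w}" using XV ge' by fastforce
          then show ?thesis using colourable_mono[OF late] by blast
        qed
      qed
    qed
  qed
qed

end

section \<open>The graph \<open>R_graph\<close> and the two general bounds\<close>

lemma R_graph_verts:
  "(i, None) \<in> pverts (R_graph m G) \<longleftrightarrow> i \<in> {1..m}"
  "(i, Some v) \<in> pverts (R_graph m G) \<longleftrightarrow> i \<in> {1..m} \<and> v \<in> pverts G"
  by (auto simp: R_graph_def)

lemma R_graph_arcs:
  "((i, None), (j, None)) \<notin> parcs (R_graph m G)"
  "((i, None), (j, Some v)) \<in> parcs (R_graph m G) \<longleftrightarrow> i = j \<and> i \<in> {1..m} \<and> v \<in> pverts G"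
  "((i, Some v), (j, None)) \<in> parcs (R_graph m G) \<longleftrightarrow> i = j \<and> i \<in> {1..m} \<and> v \<in> pverts G"
  "((i, Some u), (j, Some v)) \<in> parcs (R_graph m G) \<longleftrightarrow>
     i \<noteq> j \<and> i \<in> {1..m} \<and> j \<in> {1..m} \<and> u \<in> pverts G \<and> v \<in> pverts G \<and> (u, v) \<in> parcs G"
  by (auto simp: R_graph_def)

lemma R_graph_wf: "pair_wf_digraph (R_graph m G)"
  by unfold_locales (auto simp: R_graph_def)

lemma R_graph_loopfree: "(x, x) \<notin> parcs (R_graph m G)"
  by (auto simp: R_graph_def)

lemma finite_R_graph: "finite (pverts G) \<Longrightarrow> finite (pverts (R_graph m G))"
  by (simp add: R_graph_def)

lemma R_graph_vert_cases:
  assumes "x \<in> pverts (R_graph m G)"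
  obtains i where "x = (i, None)" "i \<in> {1..m}"
    | i v where "x = (i, Some v)" "i \<in> {1..m}" "v \<in> pverts G"
  using assms by (auto simp: R_graph_def)

lemma R_graph_arc_cases:
  assumes "(x, y) \<in> parcs (R_graph m G)"
  obtains i v where "x = (i, None)" "y = (i, Some v)" "i \<in> {1..m}" "v \<in> pverts G"
    | i v where "x = (i, Some v)" "y = (i, None)" "i \<in> {1..m}" "v \<in> pverts G"
    | i j u v where "x = (i, Some u)" "y = (j, Some v)" "i \<noteq> j" "i \<in> {1..m}" "j \<in> {1..m}"
        "u \<in> pverts G" "v \<in> pverts G" "(u, v) \<in> parcs G"
  using assms by (auto simp: R_graph_def)

text \<open>Blow each bag up to all layers, add all centres to it, and colour every centre with one
  new colour.\<close>

lemma path_chromatic_number_R_graph_le: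
  assumes "pair_graph G"
  shows "path_chromatic_number (R_graph m G) \<le> path_chromatic_number G + 1"
proof -
  interpret pair_graph G by fact
  have loopfree: "(v, v) \<notin> parcs G" for v using pair_no_loops by force
  obtain B where B: "path_decomposition G B"
    and col: "\<And>X. X \<in> set B \<Longrightarrow> colourable G X (path_chromatic_number G)"
    using optimal_path_decomposition[OF pair_wf_digraph_axioms pair_finite_verts loopfree] by blast
  note D = path_decompositionD[OF B]
  let ?b = "\<lambda>X. {1..m} \<times> insert None (Some ` X)"
  have "path_decomposition (R_graph m G) (map ?b B)"
  proof (rule path_decompositionI)
    show "map ?b B \<noteq> []" using D(1) by simp
    show "X \<subseteq> pverts (R_graph m G)" if "X \<in> set (map ?b B)" for X
      using that D(2) unfolding R_graph_def by auto
    have vert: "\<exists>t < length B. v \<in> B ! t" if "v \<in> pverts G" for v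
      using D(3)[OF that] by (auto simp: in_set_conv_nth)
    show "\<exists>t < length (map ?b B). x \<in> map ?b B ! t" if "x \<in> pverts (R_graph m G)" for x
      using that
    proof (cases rule: R_graph_vert_cases)
      case (1 i)
      then show ?thesis using D(1) by (intro exI[of _ 0]) auto
    next
      case (2 i v)
      then show ?thesis using vert by fastforce
    qed
    show "\<exists>t < length (map ?b B). x \<in> map ?b B ! t \<and> y \<in> map ?b B ! t"
      if "(x, y) \<in> parcs (R_graph m G)" for x y
      using that
    proof (cases rule: R_graph_arc_cases)
      case (1 i v)
      then show ?thesis using vert by fastforce
    next
      case (2 i v)
      then show ?thesis using vert by fastforce
    next
      case (3 i j u v)
      obtain t where "t < length B" "u \<in> B ! t" "v \<in> B ! t"
        using D(4)[OF 3(8)] by (auto simp: in_set_conv_nth)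
      then show ?thesis using 3 by (intro exI[of _ t]) auto
    qed
    show "x \<in> map ?b B ! s"
      if x: "x \<in> pverts (R_graph m G)"
        and rst: "r \<le> s" "s \<le> t" "t < length (map ?b B)" "x \<in> map ?b B ! r" "x \<in> map ?b B ! t"
      for x r s t
      using x
    proof (cases rule: R_graph_vert_cases)
      case (2 i v)
      then have "v \<in> B ! s" using D(5)[OF 2(3) rst(1,2)] rst by auto
      then show ?thesis using rst 2 by auto
    qed (use rst in auto)
  qed
  then show ?thesis
  proof (rule path_chromatic_number_leI[OF _ finite_R_graph[OF pair_finite_verts] R_graph_loopfree])
    fix Y assume "Y \<in> set (map ?b B)"
    then obtain X where X: "X \<in> set B" "Y = ?b X" by auto
    obtain c where c: "\<And>v. v \<in> X \<Longrightarrow> c v < path_chromatic_number G"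
      "\<And>u v. u \<in> X \<Longrightarrow> v \<in> X \<Longrightarrow> (u, v) \<in> parcs G \<Longrightarrow> c u \<noteq> c v"
      using col[OF X(1)] unfolding colourable_def by metis
    define c' where "c' x = (case snd x of None \<Rightarrow> path_chromatic_number G | Some v \<Rightarrow> c v)"
      for x :: "nat \<times> 'a option"
    show "colourable (R_graph m G) Y (path_chromatic_number G + 1)"
    proof (rule colourableI[of _ c'])
      show "c' x < path_chromatic_number G + 1" if "x \<in> Y" for x
        using that c(1) unfolding X c'_def by (auto intro: less_SucI)
      show "c' x \<noteq> c' y" if "x \<in> Y" "y \<in> Y" "(x, y) \<in> parcs (R_graph m G)" for x y
        using that(3)
      proof (cases rule: R_graph_arc_cases)
        case (1 i v)
        then show ?thesis using that(2) c(1)[of v] unfolding X c'_def by auto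
      next
        case (2 i v)
        then show ?thesis using that(1) c(1)[of v] unfolding X c'_def by auto
      next
        case (3 i j u v)
        then show ?thesis using that(1,2) c(2)[of u v] unfolding X c'_def by auto
      qed
    qed
  qed
qed

text \<open>Placing the vertices of \<open>G\<close> in pairwise different layers embeds
  \<open>G\<close> in \<open>R_graph m G\<close>, since copies in different layers keep the
  adjacency of \<open>G\<close>.\<close>

lemma path_chromatic_number_le_R_graph:
  assumes "pair_graph G" and "card (pverts G) \<le> m"
  shows "path_chromatic_number G \<le> path_chromatic_number (R_graph m G)"
proof -
  interpret pair_graph G by fact
  have "card (pverts G) \<le> card {1..m}" using assms(2) by simp
  then obtain f where f: "f ` pverts G \<subseteq> {1..m}" "inj_on f (pverts G)"
    using card_le_inj[OF pair_finite_verts finite_atLeastAtMost] by blast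
  have loopfree: "(v, v) \<notin> parcs G" for v using pair_no_loops by force
  show ?thesis
  proof (rule path_chromatic_number_hom[OF R_graph_wf finite_R_graph R_graph_loopfree])
    fix u v assume uv: "(u, v) \<in> parcs G"
    then have "u \<in> pverts G" "v \<in> pverts G" using in_arcsD1 in_arcsD2 by auto
    moreover have "f u \<noteq> f v" using f(2) uv calculation loopfree by (auto dest: inj_onD)
    ultimately show "u \<in> pverts G \<and> v \<in> pverts G \<and>
        ((f u, Some u), (f v, Some v)) \<in> parcs (R_graph m G)"
      using f(1) uv unfolding R_graph_arcs by auto
  qed (use f(1) pair_finite_verts in \<open>auto simp: R_graph_verts\<close>)
qed

section \<open>Path-decompositions given by enumerations\<close>

lemma mem_P_enum:
  assumes "enumeration G \<sigma>" and "l < length \<sigma>" and "j < length \<sigma>"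
  shows "\<sigma> ! j \<in> P_enum G \<sigma> ! l \<longleftrightarrow> l \<le> j \<and> (l = j \<or> (\<exists>i \<le> l. (\<sigma> ! j, \<sigma> ! i) \<in> parcs G))"
proof -
  have \<sigma>: "distinct \<sigma>" "set \<sigma> = pverts G" using assms(1) unfolding enumeration_def by auto
  have take: "\<sigma> ! j \<in> set (take p \<sigma>) \<longleftrightarrow> j < p" if "p \<le> length \<sigma>" for p
    using that assms(3) \<sigma>(1) by (auto simp: in_set_conv_nth nth_eq_iff_index_eq)
  have "(\<exists>u \<in> set (take (Suc l) \<sigma>). (\<sigma> ! j, u) \<in> parcs G) \<longleftrightarrow> (\<exists>i \<le> l. (\<sigma> ! j, \<sigma> ! i) \<in> parcs G)"
    using assms(2) by (force simp: in_set_conv_nth less_Suc_eq_le)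
  then show ?thesis
    using assms(2,3) take[of l] take[of "Suc l"] \<sigma>(2) nth_mem[OF assms(3)]
    unfolding P_enum_def closed_nbhd_def by auto
qed

lemma P_enum_subset:
  assumes "enumeration G \<sigma>" and "l < length \<sigma>"
  shows "P_enum G \<sigma> ! l \<subseteq> pverts G"
  using assms set_take_subset[of "Suc l" \<sigma>] unfolding P_enum_def closed_nbhd_def enumeration_def by auto

lemma enumeration_index:
  assumes "enumeration G \<sigma>" and "v \<in> pverts G"
  obtains j where "j < length \<sigma>" and "\<sigma> ! j = v"
  using assms unfolding enumeration_def by (metis in_set_conv_nth)

text \<open>A vertex is present from its own bag or that of its first neighbour, whichever is
  earlier, up to its own bag. An edge lies in the bag of its earlier end.\<close>

lemma path_decomposition_P_enum:
  assumes "pair_graph G" and "pverts G \<noteq> {}" and \<sigma>: "enumeration G \<sigma>"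
  shows "path_decomposition G (P_enum G \<sigma>)"
proof (rule path_decompositionI)
  interpret pair_graph G by fact
  have len: "length (P_enum G \<sigma>) = length \<sigma>" unfolding P_enum_def by simp
  show "P_enum G \<sigma> \<noteq> []" using assms(2) \<sigma> unfolding P_enum_def enumeration_def by auto
  show "X \<subseteq> pverts G" if "X \<in> set (P_enum G \<sigma>)" for X
    using that P_enum_subset[OF \<sigma>] len by (metis in_set_conv_nth)
  show "\<exists>t < length (P_enum G \<sigma>). v \<in> P_enum G \<sigma> ! t" if "v \<in> pverts G" for v
    using that mem_P_enum[OF \<sigma>] len by (metis enumeration_index[OF \<sigma>] order_refl)
  show "\<exists>t < length (P_enum G \<sigma>). u \<in> P_enum G \<sigma> ! t \<and> v \<in> P_enum G \<sigma> ! t"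
    if uv: "(u, v) \<in> parcs G" for u v
  proof -
    obtain i where i: "i < length \<sigma>" "\<sigma> ! i = u"
      using enumeration_index[OF \<sigma> in_arcsD1[OF uv]] by blast
    obtain j where j: "j < length \<sigma>" "\<sigma> ! j = v"
      using enumeration_index[OF \<sigma> in_arcsD2[OF uv]] by blast
    have "(v, u) \<in> parcs G" using uv arcs_symmetric by blast
    then show ?thesis
      using i j uv mem_P_enum[OF \<sigma>, of "min i j"] len
      by (intro exI[of _ "min i j"]) (auto simp: min_def)
  qed
  show "v \<in> P_enum G \<sigma> ! s"
    if v: "v \<in> pverts G" and rst: "r \<le> s" "s \<le> t" "t < length (P_enum G \<sigma>)"
      "v \<in> P_enum G \<sigma> ! r" "v \<in> P_enum G \<sigma> ! t" for v r s t
  proof -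
    obtain j where "j < length \<sigma>" "\<sigma> ! j = v" using enumeration_index[OF \<sigma> v] by blast
    then show ?thesis
      using rst mem_P_enum[OF \<sigma>, of r j] mem_P_enum[OF \<sigma>, of s j] mem_P_enum[OF \<sigma>, of t j] len
      by (auto intro: order_trans)
  qed
qed

text \<open>
  Otherwise \<open>X\<close> without its vertex would survive unchanged into the next bag, whose vertex has no
  earlier neighbour and hence is not in it, and so on up to the last bag.
\<close>

lemma special_bag_minus_vertex:
  assumes "pair_graph G" and "special_enumeration G \<sigma>" and "l < length \<sigma>"
  shows "colourable G (P_enum G \<sigma> ! l - {\<sigma> ! l}) (path_chromatic_number G - 1)"
  using assms(3)
proof (induction "length \<sigma> - l" arbitrary: l rule: less_induct)
  case less
  interpret pair_graph G by fact
  let ?X = "\<lambda>l. P_enum G \<sigma> ! l" and ?q = "path_chromatic_number G"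
  have loopfree: "(v, v) \<notin> parcs G" for v using pair_no_loops by force
  note sp = assms(2)[unfolded special_enumeration_def]
  have \<sigma>: "enumeration G \<sigma>" using sp by blast
  have idx: "\<exists>j < length \<sigma>. \<sigma> ! j = v" if "v \<in> ?X l" for v
    using that P_enum_subset[OF \<sigma> less.prems] \<sigma> unfolding enumeration_def by (metis in_set_conv_nth subsetD)
  show ?case
  proof (cases "Suc l < length \<sigma>")
    case False
    \<comment> \<open>The last bag contains nothing but its own vertex.\<close>
    have "?X l - {\<sigma> ! l} = {}"
    proof -
      have "v = \<sigma> ! l" if v: "v \<in> ?X l" for v
      proof -
        obtain j where j: "j < length \<sigma>" "\<sigma> ! j = v" using idx[OF v] by blast
        then have "l \<le> j" using v mem_P_enum[OF \<sigma> less.prems j(1)] by simp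
        then have "j = l" using j(1) False by linarith
        then show ?thesis using j by simp
      qed
      then show ?thesis by blast
    qed
    then show ?thesis by (intro colourableI[of _ "\<lambda>_. 0"]) blast+
  next
    case True
    have sub: "?X l - {\<sigma> ! l} \<subseteq> ?X (Suc l)"
    proof
      fix v assume v: "v \<in> ?X l - {\<sigma> ! l}"
      then obtain j where j: "j < length \<sigma>" "\<sigma> ! j = v" using idx by blast
      then show "v \<in> ?X (Suc l)"
        using v mem_P_enum[OF \<sigma> less.prems j(1)] mem_P_enum[OF \<sigma> True j(1)]
        by (metis DiffE Suc_leI le_SucI le_neq_implies_less singletonI)
    qed
    show ?thesis
    proof (cases "colourable G (?X (Suc l)) (?q - 1)")
      case col: True
      then show ?thesis using colourable_mono[OF _ sub] by blast
    next
      case nc: False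
      have fin: "finite (?X (Suc l))"
        using P_enum_subset[OF \<sigma> True] pair_finite_verts finite_subset by blast
      have "?X (Suc l) \<in> set (P_enum G \<sigma>)" using True unfolding P_enum_def by auto
      then have "chi G (?X (Suc l)) \<le> decomposition_chromatic_number G (P_enum G \<sigma>)"
        unfolding decomposition_chromatic_number_def by (intro Max_ge) auto
      moreover have "\<not> chi G (?X (Suc l)) \<le> ?q - 1"
        using nc chi_le_iff_colourable[OF fin loopfree] by blast
      \<comment> \<open>The next bag is not \<open>(?k - 1)\<close>-colourable, so its chromatic
        number is the maximum allowed by (i), and (ii) applies to its vertex.\<close>
      ultimately have "chi G (?X (Suc l)) = ?q" using sp by linarith
      then have iso: "(\<sigma> ! Suc l, u) \<notin> parcs G" if "u \<in> set (take (Suc l) \<sigma>)" for u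
        using sp True that by blast
      have "\<sigma> ! Suc l \<notin> ?X l"
      proof
        assume "\<sigma> ! Suc l \<in> ?X l"
        then obtain i where "i \<le> l" "(\<sigma> ! Suc l, \<sigma> ! i) \<in> parcs G"
          using mem_P_enum[OF \<sigma> less.prems True] by auto
        moreover from this have "\<sigma> ! i \<in> set (take (Suc l) \<sigma>)"
          using less.prems nth_mem[of i "take (Suc l) \<sigma>"] by simp
        ultimately show False using iso by blast
      qed
      then have "?X l - {\<sigma> ! l} \<subseteq> ?X (Suc l) - {\<sigma> ! Suc l}" using sub by blast
      then show ?thesis using colourable_mono[OF less.hyps[of "Suc l"]] True less.prems by auto
    qed
  qed
qed

section \<open>From a special enumeration to a decomposition of \<open>R_graph\<close>\<close>

text \<open>Each bag of \<open>P_enum\<close> becomes a block of \<open>m\<close> bags, one per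
  layer. A \<open>(k - 1)\<close>-colourable bag leaves a whole colour for the centres. In the other
  bags specialness lets the copies of the current vertex appear one at a time, and the remaining
  vertices need only \<open>k - 1\<close> colours by
  \<open>special_bag_minus_vertex\<close>.\<close>

lemma path_chromatic_number_R_graph_special:
  assumes "pair_graph G" and "pverts G \<noteq> {}" and "2 \<le> path_chromatic_number G" and "1 \<le> m"
    and special: "special_enumeration G \<sigma>"
  shows "path_chromatic_number (R_graph m G) \<le> path_chromatic_number G"
proof -
  interpret pair_graph G by fact
  let ?k = "path_chromatic_number G" and ?n = "length \<sigma>" and ?X = "\<lambda>l. P_enum G \<sigma> ! l"
  have loopfree: "(v, v) \<notin> parcs G" for v using pair_no_loops by force
  note sp = special[unfolded special_enumeration_def]
  have \<sigma>: "enumeration G \<sigma>" using sp by blast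
  have dist: "distinct \<sigma>" and set\<sigma>: "set \<sigma> = pverts G" using \<sigma> unfolding enumeration_def by auto
  \<comment> \<open>A vertex with an earlier neighbour is already present before its block, and its
    copies stay for the whole block. Without one, each copy occupies a single bag, that of its
    layer.\<close>
  define has_prev where "has_prev l \<longleftrightarrow> (\<exists>i < l. (\<sigma> ! l, \<sigma> ! i) \<in> parcs G)" for l
  \<comment> \<open>Bag \<open>l * m + (j - 1)\<close> serves layer \<open>j\<close> of the \<open>l\<close>-th vertex.\<close>
  define inb where "inb t j q \<longleftrightarrow> q = t div m \<and> (j = Suc (t mod m) \<or> has_prev q) \<or>
      t div m < q \<and> (\<exists>i \<le> t div m. (\<sigma> ! q, \<sigma> ! i) \<in> parcs G)" for t j q
  define b where "b t = {1..m} \<times> {None} \<union> {(j, Some (\<sigma> ! q)) | j q. j \<in> {1..m} \<and> q < ?n \<and> inb t j q}" for t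
  have memN: "(j, None) \<in> b t \<longleftrightarrow> j \<in> {1..m}" for t j unfolding b_def by auto
  have memS: "(j, Some (\<sigma> ! q)) \<in> b t \<longleftrightarrow> j \<in> {1..m} \<and> inb t j q" if "q < ?n" for t j q
    using that dist unfolding b_def by (auto simp: nth_eq_iff_index_eq)
  let ?B = "map b [0..<?n * m]"
  have idx: "t div m < ?n" if "t < ?n * m" for t using that by (rule less_mult_imp_div_less)
  have slot: "l * m + (j - 1) < ?n * m" "(l * m + (j - 1)) div m = l" "Suc ((l * m + (j - 1)) mod m) = j"
    if "l < ?n" "j \<in> {1..m}" for l j
  proof -
    have "l * m + (j - 1) < Suc l * m" using that(2) by auto
    also have "\<dots> \<le> ?n * m" using that(1) by (intro mult_le_mono1) simp
    finally show "l * m + (j - 1) < ?n * m" .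
    show "(l * m + (j - 1)) div m = l" "Suc ((l * m + (j - 1)) mod m) = j"
      using that(2) by (cases j; simp)+
  qed
  have "path_decomposition (R_graph m G) ?B"
  proof (rule path_decompositionI)
    have "0 < ?n" using assms(2) set\<sigma> by auto
    then show "?B \<noteq> []" using assms(4) by simp
    show "X \<subseteq> pverts (R_graph m G)" if "X \<in> set ?B" for X
      using that set\<sigma> unfolding b_def R_graph_def by (auto 0 3)
    have vert: "\<exists>t < length ?B. (j, None) \<in> ?B ! t \<and> (j, Some v) \<in> ?B ! t"
      if j: "j \<in> {1..m}" and v: "v \<in> pverts G" for j v
    proof -
      obtain q where q: "q < ?n" "\<sigma> ! q = v" using enumeration_index[OF \<sigma> v] by blast
      have "(j, Some v) \<in> b (q * m + (j - 1))"
        using memS[OF q(1)] slot[OF q(1) j] j q(2) unfolding inb_def by metis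
      then show ?thesis
        using slot(1)[OF q(1) j] memN j by (intro exI[of _ "q * m + (j - 1)"]) auto
    qed
    show "\<exists>t < length ?B. x \<in> ?B ! t" if "x \<in> pverts (R_graph m G)" for x
      using that
    proof (cases rule: R_graph_vert_cases)
      case (1 i)
      then show ?thesis using vert assms(2) by blast
    next
      case (2 i v)
      then show ?thesis using vert by blast
    qed
    have edge: "\<exists>t < length ?B. (i, Some (\<sigma> ! p)) \<in> ?B ! t \<and> (j, Some (\<sigma> ! q)) \<in> ?B ! t"
      if "i \<in> {1..m}" "j \<in> {1..m}" "p < q" "q < ?n" "(\<sigma> ! q, \<sigma> ! p) \<in> parcs G" for i j p q
    proof -
      have p: "p < ?n" using that by simp
      \<comment> \<open>The bag belonging to \<open>(i, p)\<close>; the later neighbour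
        \<open>q\<close> is present there in every layer.\<close>
      let ?t = "p * m + (i - 1)"
      have "inb ?t i p" "inb ?t j q"
        unfolding inb_def slot(2,3)[OF p that(1)] using that(3,5) by auto
      then show ?thesis
        using memS[OF p] memS[OF that(4)] slot(1)[OF p that(1)] that(1,2) by (intro exI[of _ ?t]) auto
    qed
    show "\<exists>t < length ?B. x \<in> ?B ! t \<and> y \<in> ?B ! t" if "(x, y) \<in> parcs (R_graph m G)" for x y
      using that
    proof (cases rule: R_graph_arc_cases)
      case (1 i v)
      then show ?thesis using vert by blast
    next
      case (2 i v)
      then show ?thesis using vert by blast
    next
      case (3 i j u v)
      obtain p where p: "p < ?n" "\<sigma> ! p = u" using enumeration_index[OF \<sigma> 3(6)] by blast
      obtain q where q: "q < ?n" "\<sigma> ! q = v" using enumeration_index[OF \<sigma> 3(7)] by blast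
      have uv: "(\<sigma> ! p, \<sigma> ! q) \<in> parcs G" "(\<sigma> ! q, \<sigma> ! p) \<in> parcs G"
        using 3(8) p q arcs_symmetric by auto
      then have "p \<noteq> q" using loopfree by metis
      then consider "p < q" | "q < p" by linarith
      then show ?thesis
      proof cases
        case 1
        then show ?thesis using edge[OF 3(4,5) 1 q(1) uv(2)] p q 3(1,2) by blast
      next
        case 2
        then show ?thesis using edge[OF 3(5,4) 2 p(1) uv(1)] p q 3(1,2) by blast
      qed
    qed
    show "x \<in> ?B ! s"
      if x: "x \<in> pverts (R_graph m G)"
        and rst: "r \<le> s" "s \<le> t" "t < length ?B" "x \<in> ?B ! r" "x \<in> ?B ! t" for x r s t
      using x
    proof (cases rule: R_graph_vert_cases)
      case (1 i)
      then show ?thesis using rst memN by simp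
    next
      case (2 j v)
      obtain q where q: "q < ?n" "\<sigma> ! q = v" using enumeration_index[OF \<sigma> 2(3)] by blast
      have rt: "inb r j q" "inb t j q" using rst 2 q memS[OF q(1)] by auto
      have div: "r div m \<le> s div m" "s div m \<le> t div m" using rst by (auto intro: div_le_mono)
      have "inb s j q"
      proof (cases "has_prev q")
        case True
        show ?thesis
        proof (cases "s div m = q")
          case False
          then have "s div m < q" "r div m \<noteq> q" using div rt unfolding inb_def by linarith+
          then show ?thesis using rt(1) div(1) unfolding inb_def by (meson order_trans)
        qed (use True in \<open>simp add: inb_def\<close>)
      next
        case False
        then have "r div m = q" "t div m = q" "r mod m = t mod m"
          using rt div unfolding inb_def has_prev_def by (auto dest: le_less_trans)
        then have "r = t" by (metis div_mult_mod_eq)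
        then show ?thesis using rst rt by simp
      qed
      then show ?thesis using rst 2 q memS[OF q(1)] by auto
    qed
  qed
  then show ?thesis
  proof (rule path_chromatic_number_leI[OF _ finite_R_graph[OF pair_finite_verts] R_graph_loopfree])
    fix Y assume "Y \<in> set ?B"
    then obtain t where t: "t < ?n * m" "Y = b t" by auto
    let ?l = "t div m"
    have l: "?l < ?n" using idx[OF t(1)] .
    \<comment> \<open>Forgetting layers maps the bag into \<open>?X ?l\<close>; the current vertex
      appears outside layer \<open>Suc (t mod m)\<close> only if it has an earlier
      neighbour.\<close>
    have inX: "v \<in> ?X ?l" "v \<noteq> \<sigma> ! ?l \<or> j = Suc (t mod m) \<or> has_prev ?l" if jv: "(j, Some v) \<in> Y" for j v
    proof -
      obtain q where q: "v = \<sigma> ! q" "q < ?n" "inb t j q"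
        using jv unfolding t b_def by auto
      show "v \<in> ?X ?l" using q mem_P_enum[OF \<sigma> l q(2)] unfolding inb_def by auto
      show "v \<noteq> \<sigma> ! ?l \<or> j = Suc (t mod m) \<or> has_prev ?l"
        using q l dist unfolding inb_def by (auto simp: nth_eq_iff_index_eq)
    qed
    show "colourable (R_graph m G) Y ?k"
    proof (cases "colourable G (?X ?l) (?k - 1)")
      case True
      then obtain c where c: "\<And>v. v \<in> ?X ?l \<Longrightarrow> c v < ?k - 1"
        "\<And>u v. u \<in> ?X ?l \<Longrightarrow> v \<in> ?X ?l \<Longrightarrow> (u, v) \<in> parcs G \<Longrightarrow> c u \<noteq> c v"
        unfolding colourable_def by metis
      \<comment> \<open>Copies inherit the colours of their vertices, and the spare colour
        \<open>?k - 1\<close> serves all centres.\<close>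
      define c' where "c' x = (case snd x of None \<Rightarrow> ?k - 1 | Some v \<Rightarrow> c v)" for x :: "nat \<times> 'a option"
      have c'S: "c' (j, Some v) < ?k - 1" if "(j, Some v) \<in> Y" for j v
        using c(1)[OF inX(1)[OF that]] unfolding c'_def by simp
      have c'N: "c' (j, None) = ?k - 1" for j unfolding c'_def by simp
      show ?thesis
      proof (rule colourableI[of _ c'])
        show "c' x < ?k" if "x \<in> Y" for x
        proof (cases x)
          case (Pair j y)
          then show ?thesis using that c'S[of j] c'N[of j] assms(3) by (cases y) fastforce+
        qed
        show "c' x \<noteq> c' y" if xy: "x \<in> Y" "y \<in> Y" and arc: "(x, y) \<in> parcs (R_graph m G)" for x y
          using arc
        proof (cases rule: R_graph_arc_cases)
          case (1 i v)
          then show ?thesis using c'S[of i v] c'N[of i] xy by auto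
        next
          case (2 i v)
          then show ?thesis using c'S[of i v] c'N[of i] xy by auto
        next
          case (3 i j u v)
          then show ?thesis using c(2)[OF inX(1) inX(1)] xy unfolding c'_def by simp
        qed
      qed
    next
      case False
      have fin: "finite (?X ?l)"
        using P_enum_subset[OF \<sigma> l] pair_finite_verts finite_subset by blast
      have "?X ?l \<in> set (P_enum G \<sigma>)" using l unfolding P_enum_def by auto
      then have "chi G (?X ?l) \<le> decomposition_chromatic_number G (P_enum G \<sigma>)"
        unfolding decomposition_chromatic_number_def by (intro Max_ge) auto
      moreover have "\<not> chi G (?X ?l) \<le> ?k - 1"
        using False chi_le_iff_colourable[OF fin loopfree] by blast
      ultimately have "chi G (?X ?l) = ?k" using sp by linarith
      then have "(\<sigma> ! ?l, u) \<notin> parcs G" if "u \<in> set (take ?l \<sigma>)" for u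
        using sp l that by blast
      then have no_prev: "\<not> has_prev ?l" using l unfolding has_prev_def by (fastforce simp: in_set_conv_nth)
      let ?Y = "?X ?l - {\<sigma> ! ?l}" and ?i = "Suc (t mod m)"
      obtain c where c: "\<And>v. v \<in> ?Y \<Longrightarrow> c v < ?k - 1"
        "\<And>u v. u \<in> ?Y \<Longrightarrow> v \<in> ?Y \<Longrightarrow> (u, v) \<in> parcs G \<Longrightarrow> c u \<noteq> c v"
        using special_bag_minus_vertex[OF assms(1) special l] unfolding colourable_def by metis
      \<comment> \<open>Non-centres of one layer are pairwise non-adjacent, so layer
        \<open>?i\<close> can use \<open>?k - 1\<close> throughout, with 0 for its centre; these
        colours differ since \<open>?k >= 2\<close>. In the other layers \<open>?k - 1\<close> goes
        to the centre and the rest is coloured by \<open>c\<close>.\<close>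
      define c' where "c' x = (case x of (j, None) \<Rightarrow> if j = ?i then 0 else ?k - 1
        | (j, Some v) \<Rightarrow> if j = ?i then ?k - 1 else c v)" for x :: "nat \<times> 'a option"
      have c'N: "c' (j, None) = (if j = ?i then 0 else ?k - 1)" for j unfolding c'_def by simp
      have c'S: "c' (j, Some v) = (if j = ?i then ?k - 1 else c v)" for j v unfolding c'_def by simp
      have inY: "v \<in> ?Y" if "(j, Some v) \<in> Y" "j \<noteq> ?i" for j v
        using inX[OF that(1)] that(2) no_prev by blast
      have cv: "c v < ?k - 1" if "(j, Some v) \<in> Y" "j \<noteq> ?i" for j v
        using c(1)[OF inY[OF that]] .
      show ?thesis
      proof (rule colourableI[of _ c'])
        show "c' x < ?k" if "x \<in> Y" for x
        proof (cases x)
          case (Pair j y)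
          show ?thesis
          proof (cases y)
            case None
            then show ?thesis using Pair c'N[of j] assms(3) by (auto split: if_splits)
          next
            case (Some v)
            then show ?thesis using Pair c'S[of j v] cv[of j v] that assms(3) by (auto split: if_splits)
          qed
        qed
        show "c' x \<noteq> c' y" if xy: "x \<in> Y" "y \<in> Y" and arc: "(x, y) \<in> parcs (R_graph m G)" for x y
          using arc
        proof (cases rule: R_graph_arc_cases)
          case (1 i v)
          then show ?thesis using c'S[of i v] c'N[of i] cv[of i v] xy assms(3) by (auto split: if_splits)
        next
          case (2 i v)
          then show ?thesis using c'S[of i v] c'N[of i] cv[of i v] xy assms(3) by (auto split: if_splits)
        next
          case (3 i j u v)
          then show ?thesis
            using c'S[of i u] c'S[of j v] cv[of i u] cv[of j v] inY[of i u] inY[of j v] c(2)[of u v] xy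
            by (auto split: if_splits)
        qed
      qed
    qed
  qed
qed

section \<open>From a decomposition of \<open>R_graph\<close> to a special enumeration\<close>

text \<open>By \<open>le\<close>, the bags of an optimal decomposition of \<open>R_graph m G\<close>
  are \<open>k\<close>-colourable, so its intervals and bag colourings instantiate
  \<open>layered_intervals\<close>. Sorting the vertices by the key from
  \<open>special_sort_key\<close> gives the enumeration.\<close>

lemma special_enumeration_exists:
  assumes "pair_graph G" and "pverts G \<noteq> {}" and "1 \<le> path_chromatic_number G"
    and many: "card (pverts G) + path_chromatic_number G + 2 \<le> m"
    and le: "path_chromatic_number (R_graph m G) \<le> path_chromatic_number G"
  shows "\<exists>\<sigma>. special_enumeration G \<sigma>"
proof -
  interpret pair_graph G by fact
  let ?k = "path_chromatic_number G"
  have loopfree: "(v, v) \<notin> parcs G" for v using pair_no_loops by force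
  obtain B where B: "path_decomposition (R_graph m G) B"
    and col: "\<And>X. X \<in> set B \<Longrightarrow> colourable (R_graph m G) X (path_chromatic_number (R_graph m G))"
    using optimal_path_decomposition[OF R_graph_wf finite_R_graph[OF pair_finite_verts] R_graph_loopfree]
    by blast
  obtain L R where LR: "\<And>x. x \<in> pverts (R_graph m G) \<Longrightarrow> L x \<le> R x"
    and Rlen: "\<And>x. x \<in> pverts (R_graph m G) \<Longrightarrow> R x < length B"
    and mem: "\<And>x t. x \<in> pverts (R_graph m G) \<Longrightarrow> L x \<le> t \<Longrightarrow> t \<le> R x \<Longrightarrow> x \<in> B ! t"
    and meet: "\<And>x y. (x, y) \<in> parcs (R_graph m G) \<Longrightarrow> L x \<le> R y \<and> L y \<le> R x"
    using path_decomposition_intervals[OF B] by blast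
  have "\<exists>c. (\<forall>x \<in> B ! t. c x < ?k) \<and>
      (\<forall>x \<in> B ! t. \<forall>y \<in> B ! t. (x, y) \<in> parcs (R_graph m G) \<longrightarrow> c x \<noteq> c y)" if "t < length B" for t
    using colourable_mono[OF col[OF nth_mem[OF that]] order_refl le] unfolding colourable_def .
  then obtain C where C: "\<And>t x. t < length B \<Longrightarrow> x \<in> B ! t \<Longrightarrow> C t x < ?k"
    "\<And>t x y. t < length B \<Longrightarrow> x \<in> B ! t \<Longrightarrow> y \<in> B ! t \<Longrightarrow> (x, y) \<in> parcs (R_graph m G) \<Longrightarrow> C t x \<noteq> C t y"
    by metis
  have C_less: "C t x < ?k" if "x \<in> pverts (R_graph m G)" "L x \<le> t" "t \<le> R x" for t x
    using C(1) mem[OF that] Rlen[OF that(1)] that(3) by simp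
  have C_neq: "C t x \<noteq> C t y"
    if "(x, y) \<in> parcs (R_graph m G)" "L x \<le> t" "t \<le> R x" "L y \<le> t" "t \<le> R y" for t x y
  proof -
    have "x \<in> pverts (R_graph m G)" "y \<in> pverts (R_graph m G)"
      using pair_wf_digraph.in_arcsD1[OF R_graph_wf that(1)]
        pair_wf_digraph.in_arcsD2[OF R_graph_wf that(1)] by auto
    then show ?thesis using C(2)[OF _ _ _ that(1)] mem Rlen that(2-) by (meson le_less_trans)
  qed
  interpret layered_intervals "pverts G" "parcs G" m ?k "\<lambda>i v. L (i, Some v)" "\<lambda>i v. R (i, Some v)"
    "\<lambda>i. L (i, None)" "\<lambda>i. R (i, None)" "\<lambda>t i v. C t (i, Some v)" "\<lambda>t i. C t (i, None)"
  proof
    fix i j t u v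
    show "finite (pverts G)" by (rule pair_finite_verts)
    show "(v, v) \<notin> parcs G" by (rule loopfree)
    show "1 \<le> ?k" "card (pverts G) + ?k + 2 \<le> m" by fact+
    show "(v, u) \<in> parcs G" if "(u, v) \<in> parcs G" using that arcs_symmetric by blast
    show "u \<in> pverts G" if "(u, v) \<in> parcs G" using that by (rule in_arcsD1)
    show "L (i, Some v) \<le> R (i, Some v)" if "i \<in> {1..m}" "v \<in> pverts G"
      using that LR by (simp add: R_graph_verts)
    show "L (i, None) \<le> R (i, None)" if "i \<in> {1..m}"
      using that LR by (simp add: R_graph_verts)
    show "L (i, Some v) \<le> R (i, None) \<and> L (i, None) \<le> R (i, Some v)"
      if "i \<in> {1..m}" "v \<in> pverts G"
      using that meet[of "(i, Some v)" "(i, None)"] by (simp add: R_graph_arcs)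
    show "L (i, Some u) \<le> R (j, Some v)"
      if "i \<in> {1..m}" "j \<in> {1..m}" "i \<noteq> j" "(u, v) \<in> parcs G"
      using that meet[of "(i, Some u)" "(j, Some v)"] in_arcsD1 in_arcsD2 by (simp add: R_graph_arcs)
    show "C t (i, Some v) < ?k"
      if "i \<in> {1..m}" "v \<in> pverts G" "L (i, Some v) \<le> t" "t \<le> R (i, Some v)"
      using that C_less by (simp add: R_graph_verts)
    show "C t (i, None) < ?k" if "i \<in> {1..m}" "L (i, None) \<le> t" "t \<le> R (i, None)"
      using that C_less by (simp add: R_graph_verts)
    show "C t (i, Some u) \<noteq> C t (j, Some v)"
      if "i \<in> {1..m}" "j \<in> {1..m}" "i \<noteq> j" "(u, v) \<in> parcs G"
        "L (i, Some u) \<le> t" "t \<le> R (i, Some u)" "L (j, Some v) \<le> t" "t \<le> R (j, Some v)"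
      using that C_neq[of "(i, Some u)" "(j, Some v)" t] in_arcsD1 in_arcsD2 by (simp add: R_graph_arcs)
    show "C t (i, Some v) \<noteq> C t (i, None)"
      if "i \<in> {1..m}" "v \<in> pverts G" "L (i, Some v) \<le> t" "t \<le> R (i, Some v)"
        "L (i, None) \<le> t" "t \<le> R (i, None)"
      using that C_neq[of "(i, Some v)" "(i, None)" t] by (simp add: R_graph_arcs)
  qed
  \<comment> \<open>The locale rebuilds its graph as a record from vertices and arcs; this
    identifies it with the given \<open>G\<close>.\<close>
  have G_eq: "\<lparr>pverts = pverts G, parcs = parcs G\<rparr> = G" by simp
  obtain key :: "'a \<Rightarrow> nat" where key: "\<And>P v X. P \<subseteq> pverts G \<Longrightarrow> v \<in> pverts G - P \<Longrightarrow>
      (\<And>u. u \<in> P \<Longrightarrow> key u \<le> key v) \<Longrightarrow> (\<And>w. w \<in> pverts G - P \<Longrightarrow> key v \<le> key w) \<Longrightarrow>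
      X = {w \<in> pverts G - P. w = v \<or> (\<exists>u \<in> insert v P. (u, w) \<in> parcs G)} \<Longrightarrow>
      colourable G X (?k - 1) \<or> colourable G X ?k \<and> (\<forall>u \<in> P. (u, v) \<notin> parcs G)"
    using special_sort_key unfolding G_eq by blast
  obtain vs where vs: "set vs = pverts G" "distinct vs"
    using finite_distinct_list[OF pair_finite_verts] by blast
  define \<sigma> where "\<sigma> = sort_key key vs"
  have \<sigma>: "enumeration G \<sigma>" unfolding \<sigma>_def enumeration_def using vs by simp
  have set\<sigma>: "set \<sigma> = pverts G" and dist: "distinct \<sigma>" using \<sigma> unfolding enumeration_def by auto
  have mono: "key (\<sigma> ! i) \<le> key (\<sigma> ! j)" if "i \<le> j" "j < length \<sigma>" for i j
    using sorted_nth_mono[of "map key \<sigma>" i j] that unfolding \<sigma>_def by simp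
  have bags: "colourable G (P_enum G \<sigma> ! l) (?k - 1) \<or>
      colourable G (P_enum G \<sigma> ! l) ?k \<and> (\<forall>u \<in> set (take l \<sigma>). (u, \<sigma> ! l) \<notin> parcs G)"
    if l: "l < length \<sigma>" for l
  proof (rule key)
    show "set (take l \<sigma>) \<subseteq> pverts G" using set_take_subset set\<sigma> by metis
    have notin: "\<sigma> ! j \<in> set (take l \<sigma>) \<longleftrightarrow> j < l" if "j < length \<sigma>" for j
      using that l dist by (auto simp: in_set_conv_nth nth_eq_iff_index_eq)
    show "\<sigma> ! l \<in> pverts G - set (take l \<sigma>)" using notin[OF l] set\<sigma> nth_mem[OF l] by auto
    show "key u \<le> key (\<sigma> ! l)" if "u \<in> set (take l \<sigma>)" for u
      using that mono l by (auto simp: in_set_conv_nth)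
    show "key (\<sigma> ! l) \<le> key w" if w: "w \<in> pverts G - set (take l \<sigma>)" for w
    proof -
      obtain j where "j < length \<sigma>" "\<sigma> ! j = w" using enumeration_index[OF \<sigma>] w by blast
      then show ?thesis using w notin[of j] mono[of l j] by auto
    qed
    have "set (take (Suc l) \<sigma>) = insert (\<sigma> ! l) (set (take l \<sigma>))"
      using l by (simp add: take_Suc_conv_app_nth)
    then show "P_enum G \<sigma> ! l = {w \<in> pverts G - set (take l \<sigma>). w = \<sigma> ! l \<or>
        (\<exists>u \<in> insert (\<sigma> ! l) (set (take l \<sigma>)). (u, w) \<in> parcs G)}"
      using l arcs_symmetric set\<sigma> nth_mem[OF l] set_take_subset[of l \<sigma>]
      unfolding P_enum_def closed_nbhd_def by simp blast
  qed
  have PD: "path_decomposition G (P_enum G \<sigma>)"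
    by (rule path_decomposition_P_enum[OF assms(1,2) \<sigma>])
  have "colourable G X ?k" if X: "X \<in> set (P_enum G \<sigma>)" for X
  proof -
    obtain l where "l < length \<sigma>" "X = P_enum G \<sigma> ! l"
      using X unfolding P_enum_def by (auto simp: in_set_conv_nth)
    then show ?thesis using bags[of l] colourable_mono[OF _ order_refl diff_le_self] by blast
  qed
  then have "decomposition_chromatic_number G (P_enum G \<sigma>) \<le> ?k"
    using decomposition_chromatic_number_le_iff[OF PD pair_finite_verts loopfree] by blast
  then have "decomposition_chromatic_number G (P_enum G \<sigma>) = ?k"
    using path_chromatic_number_le[OF PD] by simp
  moreover have "(\<sigma> ! l, u) \<notin> parcs G"
    if l: "l < length \<sigma>" and chi: "chi G (P_enum G \<sigma> ! l) = ?k" and u: "u \<in> set (take l \<sigma>)" for l u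
  proof -
    have "finite (P_enum G \<sigma> ! l)"
      using P_enum_subset[OF \<sigma> l] pair_finite_verts finite_subset by blast
    \<comment> \<open>Chromatic number \<open>?k >= 1\<close> rules out the first alternative of
      \<open>bags\<close>; the second says that there is no earlier neighbour.\<close>
    then have "\<not> colourable G (P_enum G \<sigma> ! l) (?k - 1)"
      using chi_le_iff_colourable[OF _ loopfree] chi assms(3) by (metis Suc_pred' Suc_n_not_le_n less_eq_Suc_le One_nat_def diff_Suc_1)
    then show ?thesis using bags[OF l] u arcs_symmetric by blast
  qed
  ultimately show ?thesis using \<sigma> unfolding special_enumeration_def by blast
qed

theorem theorem1p2:
  fixes n k m :: nat and G :: "'a pair_pre_digraph"
  assumes "n \<ge> 1" and "k \<ge> 2" and "m \<ge> n + k + 2"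
    and "pair_graph G"
    and "path_chromatic_number G = k" and "card (pverts G) = n"
  shows "((\<exists>\<sigma>. special_enumeration G \<sigma>) \<longrightarrow> path_chromatic_number (R_graph m G) = k) \<and>
         (\<not> (\<exists>\<sigma>. special_enumeration G \<sigma>) \<longrightarrow> path_chromatic_number (R_graph m G) = k + 1)"
proof -
  have ne: "pverts G \<noteq> {}" using assms(1,6) by auto
  have "k \<le> path_chromatic_number (R_graph m G)" "path_chromatic_number (R_graph m G) \<le> k + 1"
    using path_chromatic_number_le_R_graph[OF assms(4), of m]
      path_chromatic_number_R_graph_le[OF assms(4), of m] assms(3,5,6) by auto
  moreover have "path_chromatic_number (R_graph m G) \<le> k" if "special_enumeration G \<sigma>" for \<sigma>
    using path_chromatic_number_R_graph_special[OF assms(4) ne _ _ that, of m] assms by simp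
  moreover have "\<exists>\<sigma>. special_enumeration G \<sigma>" if "path_chromatic_number (R_graph m G) \<le> k"
    using special_enumeration_exists[OF assms(4) ne, of m] that assms by simp
  ultimately show ?thesis by fastforce
qed

end
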